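(* Let $d\in\mathbb{N}$ and let $\mathbf{X}=(X_1,\ldots,X_d)$ be a random vector in $\mathbb{R}^d$ with independent components. Suppose that for each $i=1,\ldots,d$ there is $\alpha_i>1$ and a slowly varying function $L_i$ such that $\mathbf{E}X_i=0$, $\mathbf{P}(X_i>x)=x^{-\alpha_i}L_i(x)$ for $x>0$, and $\limsup_{x\to\infty}\mathbf{P}(X_i<-x)/\mathbf{P}(X_i>x)\in[0,\infty)$. Let $0<a_i<b_i<\infty$ with $\mathbf{P}(X_i\in(a_i,b_i))>0$ for $i=1,\ldots,d$. Let $\mathbf{S}_k$ be the sum of the first $k$ terms of a sequence of i.i.d. copies of $\mathbf{X}$. Then $$\lim_{n\to\infty}\frac{1}{(\log n)^2}\log\mathbf{P}\Big(k^{-1}\mathbf{S}_k\in\prod_{i=1}^d[a_i,b_i]\ \text{ for all } k=1,\ldots,n\Big)=-\frac12\sum_{i=1}^d\frac{\alpha_i-1}{\log b_i-\log a_i}.$$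
   Context: A measurable function $L:(0,\infty)\to(0,\infty)$ is slowly varying if $\lim_{x\to\infty}L(tx)/L(x)=1$ for every $t>0$. Here $\prod_{i=1}^d[a_i,b_i]$ denotes the Cartesian product. *)

theory Defs
  imports "HOL-Probability.Probability"
begin

(* A function on the positive half-line is represented by a total function; only its
   restriction to {0<..} matters. *)
definition slowly_varying :: "(real \<Rightarrow> real) \<Rightarrow> bool" where
  "slowly_varying L \<longleftrightarrow>
     L \<in> borel_measurable (restrict_space borel {0<..}) \<and>
     (\<forall>x>0. L x > 0) \<and>
     (\<forall>t>0. ((\<lambda>x. L (t * x) / L x) \<longlongrightarrow> 1) at_top)"

(* The sequence may live on a different probability space than the original variable. *)
definition iid_copies ::
  "'b measure \<Rightarrow> (nat \<Rightarrow> 'b \<Rightarrow> 'v::topological_space) \<Rightarrow> 'a measure \<Rightarrow> ('a \<Rightarrow> 'v) \<Rightarrow> bool" where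
  "iid_copies N Y M X \<longleftrightarrow>
     prob_space.indep_vars N (\<lambda>_. borel) Y UNIV \<and>
     (\<forall>j. distr N borel (Y j) = distr M borel X)"

end

theory Submission
  imports Defs "HOL-Real_Asymp.Real_Asymp"
begin

text \<open>
Since the coordinates are independent, the probability factorises, and the claim reduces to a
centred real random walk that has to remain between the lines \<open>a k\<close> and \<open>b k\<close>. By the law of large
numbers such a walk hardly moves on the scale of time unless a single step is of the order of the
current time. A walk that is below \<open>b m\<close> at time \<open>m\<close> is overtaken by the lower line by time
\<open>(b/a) m\<close>, so it needs a jump of order \<open>m\<close> before then. The cheapest scenario is one jump from the
lower line to the upper line in each time window from \<open>\<rho>^j\<close> to \<open>\<rho>^(j+1)\<close> with \<open>\<rho>\<close> close to \<open>b/a\<close>.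
About \<open>\<rho>^j\<close> times are available for the jump, and a step of that size has probability
\<open>\<rho>^(-\<alpha> j + o(j))\<close>, so the window costs a factor \<open>\<rho>^(-(\<alpha> - 1) j + o(j))\<close>. The product over
\<open>j \<le> ln n / ln \<rho>\<close> is \<open>exp (-(\<alpha> - 1) (ln n)^2 / (2 ln \<rho>))\<close> up to lower order terms in the exponent,
which is the claim as \<open>ln \<rho>\<close> tends to \<open>ln b - ln a\<close>.

For the upper bound (\<open>stay_cone_le\<close>) take \<open>\<rho> > b/a\<close>: staying in the cone forces an increment of order
\<open>\<rho>^j\<close> in every window, and \<open>large_deviation_bound\<close> shows that one big jump is the cheapest way to
achieve it. For the lower bound (\<open>stay_cone_ge\<close>) take \<open>\<rho> < b/a\<close>, which leaves room for fluctuations: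
\<open>stay_near_start\<close> says that a walk stays close to its start with probability at least one half, and
\<open>one_jump_probability\<close> inserts one big jump into such a path.

Throughout, the probability \<open>stay\<close> of visiting prescribed sets is defined by recursion over the first
step, which is the Markov property. Maximal inequalities, exponential bounds and the decomposition at
the jump then become inductions on the number of steps. The path space occurs only in
\<open>emeasure_seq_eq_stay\<close> and \<open>emeasure_iid_walk_eq_stay\<close>.
\<close>

section \<open>Probabilities of staying in prescribed sets\<close>

text \<open>The probability that a walk with step distribution \<open>\<mu>\<close>, started at \<open>s\<close>, is in \<open>D 0\<close> after one step,
in \<open>D 1\<close> after two steps, and so on for \<open>n\<close> steps. The start itself is unconstrained. Values in
\<^typ>\<open>ennreal\<close> spare all integrability conditions.\<close>
primrec stay :: "'v::euclidean_space measure \<Rightarrow> (nat \<Rightarrow> 'v set) \<Rightarrow> nat \<Rightarrow> 'v \<Rightarrow> ennreal" where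
  "stay \<mu> D 0 s = 1"
| "stay \<mu> D (Suc n) s = (\<integral>\<^sup>+x. indicator (D 0) (s + x) * stay \<mu> (\<lambda>k. D (Suc k)) n (s + x) \<partial>\<mu>)"

lemma stay_mono:
  assumes "\<And>k. k < n \<Longrightarrow> D k \<subseteq> E k"
  shows "stay \<mu> D n s \<le> stay \<mu> E n s"
  using assms
proof (induction n arbitrary: D E s)
  case (Suc n)
  have "indicator (D 0) (s + x) \<le> (indicator (E 0) (s + x) :: ennreal)" for x
    using Suc.prems[of 0] by (auto simp: indicator_def)
  moreover have "stay \<mu> (\<lambda>k. D (Suc k)) n (s + x) \<le> stay \<mu> (\<lambda>k. E (Suc k)) n (s + x)" for x
    by (rule Suc.IH) (use Suc.prems in auto)
  ultimately show ?case by (auto intro!: nn_integral_mono mult_mono)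
qed simp

lemma stay_translate: "stay \<mu> D n (s + c) = stay \<mu> (\<lambda>k. {y. y + c \<in> D k}) n s"
proof (induction n arbitrary: D s)
  case (Suc n)
  have "stay \<mu> (\<lambda>k. D (Suc k)) n (s + c + x) = stay \<mu> (\<lambda>k. {y. y + c \<in> D (Suc k)}) n (s + x)" for x
    using Suc.IH[of "\<lambda>k. D (Suc k)" "s + x"] by (simp add: algebra_simps)
  then show ?case
    by (auto intro!: nn_integral_cong simp: indicator_def algebra_simps)
qed simp

lemma stay_translate_le:
  assumes "\<And>k y. k < n \<Longrightarrow> y \<in> D k \<Longrightarrow> y + c \<in> E k"
  shows "stay \<mu> D n s \<le> stay \<mu> E n (s + c)"
  unfolding stay_translate using assms by (intro stay_mono) auto

locale random_walk = prob_space \<mu> for \<mu> :: "'v::euclidean_space measure" +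
  assumes sets_eq [measurable_cong]: "sets \<mu> = sets borel"
begin

lemma space_eq [simp]: "space \<mu> = UNIV"
  using sets_eq_imp_space_eq[OF sets_eq] by simp

lemma measurable_stay [measurable]:
  assumes "\<And>k. D k \<in> sets borel"
  shows "stay \<mu> D n \<in> borel_measurable borel"
  using assms
proof (induction n arbitrary: D)
  case (Suc n)
  have [measurable]: "stay \<mu> (\<lambda>k. D (Suc k)) n \<in> borel_measurable borel" "D 0 \<in> sets borel"
    using Suc by auto
  show ?case by (simp, measurable)
next
  case 0
  have "stay \<mu> D 0 = (\<lambda>s. 1)" by (rule ext) simp
  then show ?case by simp
qed

lemma measurable_stay_step:
  assumes "\<And>k. D k \<in> sets borel" "E \<in> sets borel"
  shows "(\<lambda>x. indicator E (s + x) * stay \<mu> D n (s + x)) \<in> borel_measurable \<mu>"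
proof -
  have [measurable]: "stay \<mu> D n \<in> borel_measurable borel" "E \<in> sets borel"
    using assms by auto
  show ?thesis by measurable
qed

lemma stay_le_1: "stay \<mu> D n s \<le> 1"
proof (induction n arbitrary: D s)
  case (Suc n)
  have "stay \<mu> D (Suc n) s \<le> (\<integral>\<^sup>+x. 1 \<partial>\<mu>)"
    unfolding stay.simps using Suc
    by (intro nn_integral_mono) (auto simp: indicator_def)
  also have "\<dots> = 1" using emeasure_space_1 by simp
  finally show ?case .
qed simp

text \<open>The Markov property at time \<open>n\<close>: the factor \<open>C\<close> has to be available from every point that the walk
may occupy at that time.\<close>
lemma stay_append_ge:
  assumes D: "\<And>k. D k \<in> sets borel" and n: "n > 0"
    and C: "\<And>s'. s' \<in> D (n - 1) \<Longrightarrow> stay \<mu> (\<lambda>k. D (n + k)) m s' \<ge> C"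
  shows "stay \<mu> D (n + m) s \<ge> C * stay \<mu> D n s"
  using assms
proof (induction n arbitrary: D s)
  case (Suc n)
  let ?D = "\<lambda>k. D (Suc k)"
  have *: "C * (indicator (D 0) (s + x) * stay \<mu> ?D n (s + x)) \<le>
             indicator (D 0) (s + x) * stay \<mu> ?D (n + m) (s + x)" for x
  proof (cases "s + x \<in> D 0")
    case True
    have "C * stay \<mu> ?D n (s + x) \<le> stay \<mu> ?D (n + m) (s + x)"
    proof (cases "n = 0")
      case True
      then show ?thesis using Suc.prems(3)[of "s + x"] \<open>s + x \<in> D 0\<close> by simp
    next
      case False
      then have e: "Suc (n - 1) = n" by simp
      show ?thesis
        by (rule Suc.IH) (use Suc.prems False in \<open>auto simp: e\<close>)
    qed
    then show ?thesis using True by simp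
  qed simp
  have "C * stay \<mu> D (Suc n) s = (\<integral>\<^sup>+x. C * (indicator (D 0) (s + x) * stay \<mu> ?D n (s + x)) \<partial>\<mu>)"
    unfolding stay.simps
    by (rule nn_integral_cmult[symmetric]) (use Suc.prems in \<open>intro measurable_stay_step; simp\<close>)
  also have "\<dots> \<le> stay \<mu> D (Suc n + m) s"
    using * by (auto intro!: nn_integral_mono)
  finally show ?case .
qed simp

lemma stay_append_le:
  assumes D: "\<And>k. D k \<in> sets borel" and n: "n > 0"
    and C: "\<And>s'. s' \<in> D (n - 1) \<Longrightarrow> stay \<mu> (\<lambda>k. D (n + k)) m s' \<le> C"
  shows "stay \<mu> D (n + m) s \<le> C * stay \<mu> D n s"
  using assms
proof (induction n arbitrary: D s)
  case (Suc n)
  let ?D = "\<lambda>k. D (Suc k)"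
  have *: "indicator (D 0) (s + x) * stay \<mu> ?D (n + m) (s + x) \<le>
      C * (indicator (D 0) (s + x) * stay \<mu> ?D n (s + x))" for x
  proof (cases "s + x \<in> D 0")
    case True
    have "stay \<mu> ?D (n + m) (s + x) \<le> C * stay \<mu> ?D n (s + x)"
    proof (cases "n = 0")
      case True
      then show ?thesis using Suc.prems(3)[of "s + x"] \<open>s + x \<in> D 0\<close> by simp
    next
      case False
      then have e: "Suc (n - 1) = n" by simp
      show ?thesis
        by (rule Suc.IH) (use Suc.prems False in \<open>auto simp: e\<close>)
    qed
    then show ?thesis using True by simp
  qed simp
  have "stay \<mu> D (Suc n + m) s \<le> (\<integral>\<^sup>+x. C * (indicator (D 0) (s + x) * stay \<mu> ?D n (s + x)) \<partial>\<mu>)"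
    using * by (auto intro!: nn_integral_mono)
  also have "\<dots> = C * stay \<mu> D (Suc n) s"
    unfolding stay.simps
    by (rule nn_integral_cmult) (use Suc.prems in \<open>intro measurable_stay_step; simp\<close>)
  finally show ?case .
qed simp

lemma stay_antimono:
  assumes D: "\<And>k. D k \<in> sets borel" and "m \<le> n"
  shows "stay \<mu> D n s \<le> stay \<mu> D m s"
proof (cases "m = 0")
  case True then show ?thesis by (simp add: stay_le_1)
next
  case False
  have "stay \<mu> D (m + (n - m)) s \<le> 1 * stay \<mu> D m s"
    by (rule stay_append_le) (use False D in \<open>auto simp: stay_le_1\<close>)
  then show ?thesis using assms by simp
qed

end

sublocale random_walk \<subseteq> seq: sequence_space \<mu>
  by (unfold_locales)

context random_walk begin

text \<open>Splitting off the first coordinate of an i.i.d. sequence leaves an i.i.d. sequence, which is the recursion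
that defines \<^const>\<open>stay\<close>.\<close>
lemma emeasure_seq_eq_stay:
  assumes D: "\<And>k. D k \<in> sets borel"
  shows "emeasure seq.S {\<omega> \<in> space seq.S. \<forall>k<n. s + (\<Sum>j\<le>k. \<omega> j) \<in> D k} = stay \<mu> D n s"
  using assms
proof (induction n arbitrary: D s)
  case 0
  then show ?case using seq.emeasure_space_1 by simp
next
  case (Suc n)
  let ?A = "\<lambda>D n s. {\<omega> \<in> space seq.S. \<forall>k<n. s + (\<Sum>j\<le>k. \<omega> j) \<in> D k}"
  let ?D = "\<lambda>k. D (Suc k)"
  have [measurable]: "(\<lambda>\<omega>. \<omega> j) \<in> borel_measurable seq.S" for j
    by (rule measurable_compose[OF measurable_component_singleton[of j UNIV "\<lambda>_. \<mu>"]])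
       (auto simp: measurable_ident_sets sets_eq)
  have A[measurable]: "?A D n s \<in> sets seq.S" if "\<And>k. D k \<in> sets borel" for D n s
  proof -
    have [measurable]: "D k \<in> sets borel" for k using that by simp
    show ?thesis by measurable
  qed
  have sp: "case_nat x \<omega> \<in> space seq.S" for x \<omega>
    by (auto simp: space_PiM)
  have sum: "(\<Sum>j\<le>Suc k. case_nat x \<omega> j) = x + (\<Sum>j\<le>k. \<omega> j)" for x \<omega> k
    by (simp only: sum.atMost_Suc_shift) simp
  \<comment> \<open>Membership splits into a condition on the first step and the same event for the shifted sequence, started at \<open>s + x\<close>.\<close>
  have split: "case_nat x \<omega> \<in> ?A D (Suc n) s \<longleftrightarrow> s + x \<in> D 0 \<and> \<omega> \<in> ?A ?D n (s + x)" if "\<omega> \<in> space seq.S" for x \<omega>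
    using that sp by (auto simp: All_less_Suc2 sum add.assoc simp del: sum.atMost_Suc)
  have "emeasure seq.S (?A D (Suc n) s)
     = emeasure (distr (\<mu> \<Otimes>\<^sub>M seq.S) seq.S (\<lambda>(s, \<omega>). case_nat s \<omega>)) (?A D (Suc n) s)"
    by (simp add: seq.PiM_iter)
  also have "\<dots> = (\<integral>\<^sup>+z. indicator (?A D (Suc n) s) z \<partial>distr (\<mu> \<Otimes>\<^sub>M seq.S) seq.S (\<lambda>(s, \<omega>). case_nat s \<omega>))"
    by (subst nn_integral_indicator) (use A Suc.prems in auto)
  also have "\<dots> = (\<integral>\<^sup>+z. indicator (?A D (Suc n) s) (case z of (x, \<omega>) \<Rightarrow> case_nat x \<omega>) \<partial>(\<mu> \<Otimes>\<^sub>M seq.S))"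
    by (rule nn_integral_distr) (use A Suc.prems in auto)
  also have "\<dots> = (\<integral>\<^sup>+x. (\<integral>\<^sup>+\<omega>. indicator (?A D (Suc n) s) (case_nat x \<omega>) \<partial>seq.S) \<partial>\<mu>)"
  proof (subst seq.nn_integral_fst[symmetric])
    have "?A D (Suc n) s \<in> sets seq.S" by (rule A) (rule Suc.prems)
    moreover have "(\<lambda>(x, \<omega>). case_nat x \<omega>) \<in> measurable (\<mu> \<Otimes>\<^sub>M seq.S) seq.S"
      by measurable
    ultimately show "(\<lambda>z. indicator (?A D (Suc n) s) (case z of (x, \<omega>) \<Rightarrow> case_nat x \<omega>)) \<in> borel_measurable (\<mu> \<Otimes>\<^sub>M seq.S)"
      by (intro measurable_compose[OF _ borel_measurable_indicator])
  qed simp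
  also have "\<dots> = (\<integral>\<^sup>+x. (\<integral>\<^sup>+\<omega>. indicator (D 0) (s + x) * indicator (?A ?D n (s + x)) \<omega> \<partial>seq.S) \<partial>\<mu>)"
  proof (intro nn_integral_cong)
    fix x \<omega> assume "\<omega> \<in> space seq.S"
    from split[OF this] show "indicator (?A D (Suc n) s) (case_nat x \<omega>) =
        (indicator (D 0) (s + x) * indicator (?A ?D n (s + x)) \<omega> :: ennreal)"
      unfolding indicator_def by (simp only: if_distrib) simp
  qed
  also have "\<dots> = (\<integral>\<^sup>+x. indicator (D 0) (s + x) * emeasure seq.S (?A ?D n (s + x)) \<partial>\<mu>)"
  proof (intro nn_integral_cong)
    fix x
    have "?A ?D n (s + x) \<in> sets seq.S" by (rule A) (rule Suc.prems)
    then show "(\<integral>\<^sup>+\<omega>. indicator (D 0) (s + x) * indicator (?A ?D n (s + x)) \<omega> \<partial>seq.S)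
        = indicator (D 0) (s + x) * emeasure seq.S (?A ?D n (s + x))"
      by (rule nn_integral_cmult_indicator)
  qed
  also have "\<dots> = stay \<mu> D (Suc n) s"
    unfolding stay.simps by (subst Suc.IH) (use Suc.prems in auto)
  finally show ?case .
qed

end

lemma (in prob_space) emeasure_iid_walk_eq_stay:
  fixes Y :: "nat \<Rightarrow> 'a \<Rightarrow> 'v::euclidean_space"
  assumes ind: "indep_vars (\<lambda>_. borel) Y UNIV" and d: "\<And>j. distr M borel (Y j) = \<mu>"
    and D: "\<And>k. D k \<in> sets borel"
  shows "emeasure M {\<omega> \<in> space M. \<forall>k<n. (\<Sum>j\<le>k. Y j \<omega>) \<in> D k} = stay \<mu> D n 0"
proof -
  have rv[measurable]: "random_variable borel (Y j)" for j
    using ind by (auto simp: indep_vars_def)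
  interpret W: random_walk \<mu>
    unfolding d[of 0, symmetric] random_walk_def random_walk_axioms_def using prob_space_distr[OF rv] by auto
  have "distr M (\<Pi>\<^sub>M i\<in>UNIV. borel) (\<lambda>x. \<lambda>i\<in>UNIV. Y i x) = (\<Pi>\<^sub>M i\<in>UNIV. distr M borel (Y i))"
    using indep_vars_iff_distr_eq_PiM[where I=UNIV and M'="\<lambda>_. borel" and X=Y] ind rv by simp
  then have eq: "distr M W.seq.S (\<lambda>\<omega> i. Y i \<omega>) = W.seq.S"
  proof -
    have "sets (\<Pi>\<^sub>M i\<in>(UNIV::nat set). (borel :: 'v measure)) = sets W.seq.S"
      by (intro sets_PiM_cong) (simp_all add: W.sets_eq)
    then have "distr M W.seq.S (\<lambda>\<omega> i. Y i \<omega>) = distr M (\<Pi>\<^sub>M i\<in>(UNIV::nat set). borel) (\<lambda>x. \<lambda>i\<in>UNIV. Y i x)"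
      by (intro distr_cong) (auto simp: restrict_def)
    also have "\<dots> = (\<Pi>\<^sub>M i\<in>UNIV. distr M borel (Y i))" by fact
    finally show ?thesis by (simp add: d)
  qed
  let ?A = "{\<omega> \<in> space W.seq.S. \<forall>k<n. 0 + (\<Sum>j\<le>k. \<omega> j) \<in> D k}"
  have [measurable]: "(\<lambda>\<omega>. \<omega> j) \<in> borel_measurable W.seq.S" for j
    by (rule measurable_compose[OF measurable_component_singleton[of j UNIV "\<lambda>_. \<mu>"]])
       (auto simp: measurable_ident_sets W.sets_eq)
  have A: "?A \<in> sets W.seq.S"
  proof -
    have [measurable]: "D k \<in> sets borel" for k using D by simp
    show ?thesis by measurable
  qed
  have m: "(\<lambda>\<omega> i. Y i \<omega>) \<in> measurable M W.seq.S"
    by (rule measurable_PiM_single') (auto simp: measurable_cong_sets[OF refl W.sets_eq] intro: rv)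
  have "emeasure W.seq.S ?A = emeasure (distr M W.seq.S (\<lambda>\<omega> i. Y i \<omega>)) ?A"
    by (simp add: eq)
  also have "\<dots> = emeasure M {\<omega> \<in> space M. \<forall>k<n. (\<Sum>j\<le>k. Y j \<omega>) \<in> D k}"
    by (subst emeasure_distr[OF m A]) (auto intro!: arg_cong2[of _ _ _ _ emeasure] simp: space_PiM)
  finally show ?thesis
    using W.emeasure_seq_eq_stay[OF D, where s=0 and n=n] by simp
qed

text \<open>Independence of the coordinates of one step is inherited by the walk: if the integrand of the recursion is a
product over the coordinates, so is the integral.\<close>
lemma (in prob_space) stay_eq_prod_components:
  fixes X :: "'a \<Rightarrow> real ^ 'd"
  assumes X[measurable]: "X \<in> borel_measurable M"
    and ind: "indep_vars (\<lambda>_. borel) (\<lambda>i \<omega>. X \<omega> $ i) UNIV"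
    and D: "\<And>i k. D i k \<in> sets borel"
  shows "stay (distr M borel X) (\<lambda>k. {y. \<forall>i. y $ i \<in> D i k}) n s
       = (\<Prod>i\<in>UNIV. stay (distr M borel (\<lambda>\<omega>. X \<omega> $ i)) (D i) n (s $ i))"
  using D
proof (induction n arbitrary: D s)
  case (Suc n)
  have Xi[measurable]: "(\<lambda>\<omega>. X \<omega> $ i) \<in> borel_measurable M" for i
    using ind by (auto simp: indep_vars_def)
  interpret V: random_walk "distr M borel X"
    by (auto intro!: random_walk.intro random_walk_axioms.intro prob_space_distr)
  interpret C: random_walk "distr M borel (\<lambda>\<omega>. X \<omega> $ i)" for i
    by (auto intro!: random_walk.intro random_walk_axioms.intro prob_space_distr)
  define f where "f i x = indicator (D i 0) (s $ i + x) *
      stay (distr M borel (\<lambda>\<omega>. X \<omega> $ i)) (\<lambda>k. D i (Suc k)) n (s $ i + x)" for i x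
  have f[measurable]: "f i \<in> borel_measurable borel" for i
  proof -
    have [measurable]: "stay (distr M borel (\<lambda>\<omega>. X \<omega> $ i)) (\<lambda>k. D i (Suc k)) n \<in> borel_measurable borel"
       "D i 0 \<in> sets borel"
      using Suc.prems by (auto intro!: C.measurable_stay)
    show ?thesis unfolding f_def by measurable
  qed
  have box: "{y. \<forall>i. y $ i \<in> D i k} \<in> sets borel" for k
  proof -
    have [measurable]: "D i k \<in> sets borel" for i using Suc.prems by simp
    have "{y \<in> space borel. \<forall>i. y $ i \<in> D i k} \<in> sets borel"
      by measurable
    then show ?thesis by simp
  qed
  have ind': "indep_vars (\<lambda>_. borel) (\<lambda>i \<omega>. f i (X \<omega> $ i)) UNIV"
    by (rule indep_vars_compose2[OF ind f])
  have "stay (distr M borel X) (\<lambda>k. {y. \<forall>i. y $ i \<in> D i k}) (Suc n) s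
     = (\<integral>\<^sup>+\<omega>. indicator {y. \<forall>i. y $ i \<in> D i 0} (s + X \<omega>) *
          stay (distr M borel X) (\<lambda>k. {y. \<forall>i. y $ i \<in> D i (Suc k)}) n (s + X \<omega>) \<partial>M)"
    unfolding stay.simps
    by (rule nn_integral_distr[OF X])
       (use V.measurable_stay_step[of "\<lambda>k. {y. \<forall>i. y $ i \<in> D i (Suc k)}" "{y. \<forall>i. y $ i \<in> D i 0}" s n] box in auto)
  also have "\<dots> = (\<integral>\<^sup>+\<omega>. (\<Prod>i\<in>UNIV. f i (X \<omega> $ i)) \<partial>M)"
  proof (rule nn_integral_cong)
    fix \<omega>
    have "indicator {y. \<forall>i. y $ i \<in> D i 0} (s + X \<omega>) = (\<Prod>i\<in>UNIV. indicator (D i 0) (s $ i + X \<omega> $ i) :: ennreal)"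
    proof (cases "\<forall>i. s $ i + X \<omega> $ i \<in> D i 0")
      case False
      then have "(\<Prod>i\<in>UNIV. indicator (D i 0) (s $ i + X \<omega> $ i) :: ennreal) = 0"
        by (intro prod_zero) (auto simp: indicator_def)
      then show ?thesis using False by (simp add: indicator_def)
    qed simp
    then show "indicator {y. \<forall>i. y $ i \<in> D i 0} (s + X \<omega>) *
          stay (distr M borel X) (\<lambda>k. {y. \<forall>i. y $ i \<in> D i (Suc k)}) n (s + X \<omega>) = (\<Prod>i\<in>UNIV. f i (X \<omega> $ i))"
      using Suc by (simp add: f_def prod.distrib)
  qed
  also have "\<dots> = (\<Prod>i\<in>UNIV. \<integral>\<^sup>+\<omega>. f i (X \<omega> $ i) \<partial>M)"
    by (rule indep_vars_nn_integral[OF _ ind']) auto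
  also have "\<dots> = (\<Prod>i\<in>UNIV. stay (distr M borel (\<lambda>\<omega>. X \<omega> $ i)) (D i) (Suc n) (s $ i))"
    unfolding stay.simps f_def[symmetric] by (subst nn_integral_distr[OF Xi]) (use f in auto)
  finally show ?case .
qed simp

section \<open>Power bounds for regularly varying tails\<close>

text \<open>A monotone function is controlled on all scales by its behaviour under doubling. This gives power
bounds for monotone regularly varying functions.\<close>
lemma powr_le_of_doubling:
  fixes G :: "real \<Rightarrow> real"
  assumes mono: "\<And>x y. 0 < x \<Longrightarrow> x \<le> y \<Longrightarrow> G y \<le> G x" and nonneg: "\<And>x. 0 \<le> G x"
    and "0 \<le> \<beta>" "0 < x0" and step: "\<And>x. x0 \<le> x \<Longrightarrow> G (2 * x) \<le> 2 powr - \<beta> * G x"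
  shows "\<exists>C. \<forall>x\<ge>x0. G x \<le> C * x powr - \<beta>"
proof -
  define C where "C = G x0 * (2 * x0) powr \<beta>"
  have *: "x \<le> 2 ^ k * (2 * x0) \<Longrightarrow> x0 \<le> x \<Longrightarrow> G x \<le> C * x powr - \<beta>" for x and k :: nat
  proof (induction k arbitrary: x)
    case 0
    have "(2 * x0) powr - \<beta> \<le> x powr - \<beta>"
      using 0 assms by (intro powr_mono2') auto
    have "G x \<le> G x0" using 0 assms by auto
    also have "\<dots> = C * (2 * x0) powr - \<beta>"
      using \<open>0 < x0\<close> by (simp add: C_def powr_minus field_simps)
    also have "\<dots> \<le> C * x powr - \<beta>"
      using 0 assms by (intro mult_left_mono powr_mono2') (auto simp: C_def)
    finally show ?case .
  next
    case (Suc k)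
    show ?case
    proof (cases "x \<le> 2 * x0")
      case True
      moreover have "1 * (2 * x0) \<le> 2 ^ k * (2 * x0)"
        using \<open>0 < x0\<close> by (intro mult_right_mono) auto
      ultimately have "x \<le> 2 ^ k * (2 * x0)" by linarith
      then show ?thesis using Suc by blast
    next
      case False
      have "G x = G (2 * (x / 2))" by simp
      also have "\<dots> \<le> 2 powr - \<beta> * G (x / 2)" using False by (intro step) auto
      also have "\<dots> \<le> 2 powr - \<beta> * (C * (x / 2) powr - \<beta>)"
        using False Suc by (intro mult_left_mono Suc.IH) auto
      also have "\<dots> = C * x powr - \<beta>"
        using False \<open>0 < x0\<close> by (simp add: powr_minus powr_divide field_simps)
      finally show ?thesis .
    qed
  qed
  have "G x \<le> C * x powr - \<beta>" if "x0 \<le> x" for x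
  proof -
    obtain k :: nat where "x / (2 * x0) < 2 ^ k" using real_arch_pow[of 2] by auto
    then have "x \<le> 2 ^ k * (2 * x0)" using \<open>0 < x0\<close> by (simp add: field_simps)
    with * that show ?thesis by blast
  qed
  then show ?thesis by blast
qed

lemma powr_ge_of_doubling:
  fixes G :: "real \<Rightarrow> real"
  assumes mono: "\<And>x y. 0 < x \<Longrightarrow> x \<le> y \<Longrightarrow> G y \<le> G x" and pos: "\<And>x. 0 < x \<Longrightarrow> 0 < G x"
    and "0 \<le> \<beta>" "0 < x0" and step: "\<And>x. x0 \<le> x \<Longrightarrow> 2 powr - \<beta> * G x \<le> G (2 * x)"
  shows "\<exists>C>0. \<forall>x\<ge>x0. C * x powr - \<beta> \<le> G x"
proof -
  define C where "C = G (2 * x0) * x0 powr \<beta>"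
  have C: "C > 0" using assms by (auto simp: C_def)
  have *: "x \<le> 2 ^ k * (2 * x0) \<Longrightarrow> x0 \<le> x \<Longrightarrow> C * x powr - \<beta> \<le> G x" for x and k :: nat
  proof (induction k arbitrary: x)
    case 0
    have "C * x powr - \<beta> \<le> C * x0 powr - \<beta>"
      using 0 assms C by (intro mult_left_mono powr_mono2') auto
    also have "\<dots> = G (2 * x0)"
      using \<open>0 < x0\<close> by (simp add: C_def powr_minus field_simps)
    also have "\<dots> \<le> G x" using 0 assms by auto
    finally show ?case .
  next
    case (Suc k)
    show ?case
    proof (cases "x \<le> 2 * x0")
      case True
      moreover have "1 * (2 * x0) \<le> 2 ^ k * (2 * x0)"
        using \<open>0 < x0\<close> by (intro mult_right_mono) auto
      ultimately have "x \<le> 2 ^ k * (2 * x0)" by linarith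
      then show ?thesis using Suc by blast
    next
      case False
      have "C * x powr - \<beta> = 2 powr - \<beta> * (C * (x / 2) powr - \<beta>)"
        using False \<open>0 < x0\<close> by (simp add: powr_minus powr_divide field_simps)
      also have "\<dots> \<le> 2 powr - \<beta> * G (x / 2)"
        using False Suc by (intro mult_left_mono Suc.IH) auto
      also have "\<dots> \<le> G (2 * (x / 2))" using False by (intro step) auto
      finally show ?thesis by simp
    qed
  qed
  have "C * x powr - \<beta> \<le> G x" if "x0 \<le> x" for x
  proof -
    obtain k :: nat where "x / (2 * x0) < 2 ^ k" using real_arch_pow[of 2] by auto
    then have "x \<le> 2 ^ k * (2 * x0)" using \<open>0 < x0\<close> by (simp add: field_simps)
    with * that show ?thesis by blast
  qed
  with C show ?thesis by blast
qed

text \<open>A centred step distribution whose right tail is regularly varying with index \<open>- \<alpha>\<close>.\<close>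
locale heavy_tailed_walk = random_walk \<mu> for \<mu> :: "real measure" +
  fixes \<alpha> :: real
  assumes integrable_id: "integrable \<mu> (\<lambda>x. x)" and mean_0: "(\<integral>x. x \<partial>\<mu>) = 0"
    and \<alpha>: "\<alpha> > 1"
    and tail_pos: "\<And>x. x > 0 \<Longrightarrow> 0 < measure \<mu> {x<..}"
    and tail_ratio: "\<And>t. t > 0 \<Longrightarrow>
      ((\<lambda>x. measure \<mu> {t * x<..} / measure \<mu> {x<..}) \<longlongrightarrow> t powr - \<alpha>) at_top"
begin

abbreviation G :: "real \<Rightarrow> real" where "G x \<equiv> measure \<mu> {x<..}"

lemma G_mono: "x \<le> y \<Longrightarrow> G y \<le> G x"
  by (intro finite_measure_mono) (auto simp: sets_eq)

text \<open>The tail at \<open>2 x\<close> is asymptotically \<open>2 powr - \<alpha>\<close> times the tail at \<open>x\<close>, hence eventually at most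
\<open>2 powr - \<beta>\<close> times it for any \<open>\<beta> < \<alpha>\<close>; the constant of the resulting power bound is absorbed by
a further loss in the exponent.\<close>
lemma tail_le_powr:
  assumes "0 < \<delta>" "\<delta> < \<alpha>"
  shows "eventually (\<lambda>x. G x \<le> x powr (- \<alpha> + \<delta>)) at_top"
proof -
  define \<beta> where "\<beta> = \<alpha> - \<delta> / 2"
  have "2 powr - \<alpha> < 2 powr - \<beta>" using assms by (auto simp: \<beta>_def)
  from order_tendstoD(2)[OF tail_ratio[of 2] this]
  have "eventually (\<lambda>x. G (2 * x) / G x < 2 powr - \<beta> \<and> x > 0) at_top"
    using eventually_gt_at_top[of 0] by (simp add: eventually_conj_iff)
  then obtain x0 where x0: "\<And>x. x \<ge> x0 \<Longrightarrow> G (2 * x) / G x < 2 powr - \<beta> \<and> x > 0"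
    by (auto simp: eventually_at_top_linorder)
  have "G (2 * x) \<le> 2 powr - \<beta> * G x" if "x \<ge> x0" for x
    using x0[OF that] tail_pos[of x] by (simp add: field_simps)
  then obtain C where C: "\<And>x. x \<ge> x0 \<Longrightarrow> G x \<le> C * x powr - \<beta>"
    using powr_le_of_doubling[of G \<beta> x0] G_mono x0 assms by (auto simp: \<beta>_def)
  have "filterlim (\<lambda>x::real. x powr (\<delta> / 2)) at_top at_top"
    using assms by real_asymp
  then have "eventually (\<lambda>x. C \<le> x powr (\<delta> / 2)) at_top"
    by (simp add: filterlim_at_top)
  moreover have "eventually (\<lambda>x. x \<ge> x0) at_top" by simp
  ultimately show ?thesis
  proof eventually_elim
    case (elim x)
    have "G x \<le> C * x powr - \<beta>" using C elim by auto
    also have "\<dots> \<le> x powr (\<delta> / 2) * x powr - \<beta>"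
      using elim by (intro mult_right_mono) auto
    also have "\<dots> = x powr (- \<alpha> + \<delta>)"
      by (simp add: powr_add[symmetric] \<beta>_def)
    finally show ?case .
  qed
qed

lemma tail_ge_powr:
  assumes "0 < \<delta>"
  shows "eventually (\<lambda>x. x powr (- \<alpha> - \<delta>) \<le> G x) at_top"
proof -
  define \<beta> where "\<beta> = \<alpha> + \<delta> / 2"
  have "2 powr - \<alpha> > 2 powr - \<beta>" using assms by (auto simp: \<beta>_def)
  from order_tendstoD(1)[OF tail_ratio[of 2] this]
  have "eventually (\<lambda>x. G (2 * x) / G x > 2 powr - \<beta> \<and> x > 0) at_top"
    using eventually_gt_at_top[of 0] by (simp add: eventually_conj_iff)
  then obtain x0 where x0: "\<And>x. x \<ge> x0 \<Longrightarrow> G (2 * x) / G x > 2 powr - \<beta> \<and> x > 0"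
    by (auto simp: eventually_at_top_linorder)
  have "G (2 * x) \<ge> 2 powr - \<beta> * G x" if "x \<ge> x0" for x
    using x0[OF that] tail_pos[of x] by (simp add: field_simps)
  then obtain C where C: "C > 0" "\<And>x. x \<ge> x0 \<Longrightarrow> G x \<ge> C * x powr - \<beta>"
    using powr_ge_of_doubling[of G \<beta> x0] G_mono x0 assms \<alpha> tail_pos by (auto simp: \<beta>_def)
  have "filterlim (\<lambda>x::real. x powr (\<delta> / 2)) at_top at_top"
    using assms by real_asymp
  then have "eventually (\<lambda>x. 1 / C \<le> x powr (\<delta> / 2)) at_top"
    by (simp add: filterlim_at_top)
  moreover have "eventually (\<lambda>x. x \<ge> x0) at_top" by simp
  ultimately show ?thesis
  proof eventually_elim
    case (elim x)
    have "x powr (- \<alpha> - \<delta>) * 1 \<le> x powr (- \<alpha> - \<delta>) * (C * x powr (\<delta> / 2))"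
      using elim C(1) by (intro mult_left_mono) (auto simp: field_simps)
    also have "\<dots> = C * x powr - \<beta>"
      by (simp add: powr_add[symmetric] \<beta>_def algebra_simps)
    also have "\<dots> \<le> G x" using C elim by auto
    finally show ?case by simp
  qed
qed

text \<open>Jumps of size comparable to \<open>x\<close>, but confined to a window above and below, are as likely as jumps
beyond \<open>x\<close> up to a constant factor, because \<open>u powr - \<alpha> > v powr - \<alpha>\<close>.\<close>
lemma tail_diff_ge:
  assumes "0 < u" "u < v"
  shows "\<exists>\<kappa>>0. eventually (\<lambda>x. \<kappa> * G x \<le> measure \<mu> {u * x<..v * x}) at_top"
proof -
  define \<kappa> where "\<kappa> = (u powr - \<alpha> - v powr - \<alpha>) / 2"
  have k: "\<kappa> > 0"
    using powr_less_mono2_neg[of "- \<alpha>" u v] assms \<alpha> by (auto simp: \<kappa>_def)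
  have "((\<lambda>x. G (u * x) / G x - G (v * x) / G x) \<longlongrightarrow> u powr - \<alpha> - v powr - \<alpha>) at_top"
    using assms by (intro tendsto_diff tail_ratio) auto
  from order_tendstoD(1)[OF this, of \<kappa>] k
  have "eventually (\<lambda>x. \<kappa> < G (u * x) / G x - G (v * x) / G x) at_top" by (auto simp: \<kappa>_def)
  with eventually_gt_at_top[of "0::real"]
  have "eventually (\<lambda>x. \<kappa> * G x \<le> measure \<mu> {u * x<..v * x}) at_top"
  proof eventually_elim
    case (elim x)
    have "{u * x<..v * x} = {u * x<..} - {v * x<..}" by auto
    moreover have "{v * x<..} \<subseteq> {u * x<..}" using elim assms by (auto intro!: mult_right_mono)
    ultimately have "measure \<mu> {u * x<..v * x} = G (u * x) - G (v * x)"
      by (simp add: finite_measure_Diff sets_eq)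
    then show ?case using elim tail_pos[of x] by (simp add: field_simps)
  qed
  with k show ?thesis by blast
qed

end

section \<open>Fluctuations of the walk without large jumps\<close>

context heavy_tailed_walk begin

text \<open>Removing from the interval all null intervals with rational end points removes only a null
set, so some point of the interval is left.\<close>
lemma ex_support_point:
  assumes pos: "measure \<mu> {a<..<b} > 0"
  shows "\<exists>c\<in>{a<..<b}. \<forall>\<epsilon>>0. measure \<mu> {c - \<epsilon><..<c + \<epsilon>} > 0"
proof -
  define I where "I = {(p, q) \<in> \<rat> \<times> \<rat>. measure \<mu> {p<..<q} = 0}"
  define U where "U = (\<Union>(p, q)\<in>I. {p<..<q})"
  have "countable I"
    by (rule countable_subset[of _ "\<rat> \<times> \<rat>"]) (auto simp: I_def intro: countable_rat)
  then have null: "U \<in> null_sets \<mu>"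
    unfolding U_def
    by (intro null_sets_UN') (auto simp: I_def null_sets_def sets_eq emeasure_eq_measure)
  have "\<not> {a<..<b} \<subseteq> U"
  proof
    assume "{a<..<b} \<subseteq> U"
    then have "{a<..<b} \<in> null_sets \<mu>"
      using null by (intro null_sets_subset[OF null]) (auto simp: sets_eq)
    then show False using pos by (simp add: null_sets_def emeasure_eq_measure)
  qed
  then obtain c where c: "c \<in> {a<..<b}" "c \<notin> U" by blast
  have "measure \<mu> {c - \<epsilon><..<c + \<epsilon>} > 0" if "\<epsilon> > 0" for \<epsilon>
  proof -
    have "c - \<epsilon> < c" "c < c + \<epsilon>" using that by auto
    from this[THEN Rats_dense_in_real] obtain p q
      where p: "p \<in> \<rat>" "c - \<epsilon> < p" "p < c" and q: "q \<in> \<rat>" "c < q" "q < c + \<epsilon>" by blast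
    have "measure \<mu> {p<..<q} \<noteq> 0" using c p q by (auto simp: U_def I_def)
    then have "0 < measure \<mu> {p<..<q}" using measure_nonneg[of \<mu> "{p<..<q}"] by linarith
    also have "\<dots> \<le> measure \<mu> {c - \<epsilon><..<c + \<epsilon>}"
      using p q by (intro finite_measure_mono) (auto simp: sets_eq)
    finally show ?thesis .
  qed
  with c show ?thesis by blast
qed

text \<open>Kolmogorov's maximal inequality for the steps truncated at \<open>z\<close>, by induction on the number of steps.
As long as the walk is inside \<open>{-c..c}\<close>, one truncated step raises the expected square of the position
by at most \<open>\<sigma>\<close>: the second moment of the step, and twice the position, which is at most \<open>c\<close>, times the
mean that truncation may create. When the walk leaves the interval the potential \<open>s\<^sup>2 / c\<^sup>2\<close> exceeds one and pays for
the failure; steps beyond \<open>z\<close> are paid for by \<open>\<tau>\<close>.\<close>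
lemma stay_interval_ge_variance:
  fixes c z :: real
  defines "A \<equiv> {-z..z}"
  defines "\<tau> \<equiv> measure \<mu> (- A)"
    and "\<sigma> \<equiv> (\<integral>x. indicator A x * x\<^sup>2 \<partial>\<mu>) + 2 * c * \<bar>\<integral>x. indicator A x * x \<partial>\<mu>\<bar>"
  assumes c: "c > 0" and s: "\<bar>s\<bar> \<le> c" and z: "z > 0"
  shows "1 \<le> stay \<mu> (\<lambda>_. {-c..c}) T s + ennreal (T * \<tau> + (s\<^sup>2 + T * \<sigma>) / c\<^sup>2)"
  using s
proof (induction T arbitrary: s)
  case (Suc T)
  have A[measurable]: "A \<in> sets \<mu>" by (auto simp: A_def sets_eq)
  have \<tau>0: "\<tau> \<ge> 0" by (simp add: \<tau>_def)
  have v0: "0 \<le> (\<integral>x. indicator A x * x\<^sup>2 \<partial>\<mu>)"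
    by (intro integral_nonneg_AE) auto
  have \<sigma>0: "\<sigma> \<ge> 0" using v0 c by (simp add: \<sigma>_def)
  define e where "e = (\<integral>x. indicator A x * x \<partial>\<mu>)"
  define v where "v = (\<integral>x. indicator A x * x\<^sup>2 \<partial>\<mu>)"
  have i0: "integrable \<mu> (\<lambda>x. indicator A x :: real)"
    using A by (simp add: emeasure_eq_measure)
  have i1: "integrable \<mu> (\<lambda>x. indicator A x * x)"
    using integrable_id integrable_real_mult_indicator[OF A] by (simp add: mult.commute)
  have i2: "integrable \<mu> (\<lambda>x. indicator A x * x\<^sup>2)"
  proof (rule integrable_const_bound[where B="z\<^sup>2"])
    show "AE x in \<mu>. norm (indicator A x * x\<^sup>2) \<le> z\<^sup>2"
      using z by (intro AE_I2) (auto simp: A_def indicator_def abs_le_square_iff[symmetric])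
  qed measurable
  define K where "K = T * \<tau> + T * \<sigma> / c\<^sup>2 + s\<^sup>2 / c\<^sup>2"
  define g where "g x = T * \<tau> + ((s + x)\<^sup>2 + T * \<sigma>) / c\<^sup>2" for x
  have g0: "g x \<ge> 0" for x using \<tau>0 \<sigma>0 by (simp add: g_def)
  have g_eq: "indicator A x * g x = K * indicator A x + 2 * s / c\<^sup>2 * (indicator A x * x)
      + 1 / c\<^sup>2 * (indicator A x * x\<^sup>2)" for x
    using c by (simp add: g_def K_def field_simps power2_eq_square)
  have ig: "integrable \<mu> (\<lambda>x. indicator A x * g x)"
    unfolding g_eq using i0 i1 i2 by (intro Bochner_Integration.integrable_add integrable_mult_right)
  have "(\<integral>x. indicator A x * g x \<partial>\<mu>) = K * measure \<mu> A + 2 * s / c\<^sup>2 * e + 1 / c\<^sup>2 * v"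
    unfolding g_eq using i0 i1 i2 by (simp add: e_def v_def)
  also have "\<dots> \<le> K * 1 + 2 * s / c\<^sup>2 * e + 1 / c\<^sup>2 * v"
    using \<tau>0 \<sigma>0 by (intro add_right_mono mult_left_mono) (auto simp: K_def)
  also have "2 * s / c\<^sup>2 * e \<le> 2 * c / c\<^sup>2 * \<bar>e\<bar>"
  proof -
    have "s * e \<le> \<bar>s\<bar> * \<bar>e\<bar>" by (metis abs_ge_self abs_mult)
    also have "\<dots> \<le> c * \<bar>e\<bar>" using Suc.prems by (intro mult_right_mono) auto
    finally show ?thesis using c by (simp add: divide_right_mono)
  qed
  also have "K * 1 + 2 * c / c\<^sup>2 * \<bar>e\<bar> + 1 / c\<^sup>2 * v = T * \<tau> + (s\<^sup>2 + Suc T * \<sigma>) / c\<^sup>2"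
  proof -
    have "\<sigma> / c\<^sup>2 = v / c\<^sup>2 + 2 * c / c\<^sup>2 * \<bar>e\<bar>"
      by (simp add: \<sigma>_def e_def v_def add_divide_distrib)
    then show ?thesis by (simp add: K_def add_divide_distrib distrib_right)
  qed
  finally have ig_le: "(\<integral>x. indicator A x * g x \<partial>\<mu>) \<le> T * \<tau> + (s\<^sup>2 + Suc T * \<sigma>) / c\<^sup>2" by simp
  have [measurable]: "stay \<mu> (\<lambda>_. {-c..c}) T \<in> borel_measurable borel"
    by (rule measurable_stay) auto
  have gm[measurable]: "g \<in> borel_measurable borel"
    unfolding g_def by measurable
  \<comment> \<open>One step of the potential argument: the walk survives, makes a step beyond \<open>z\<close>, or is charged the potential \<open>g\<close>.\<close>
  have pw: "1 \<le> indicator {-c..c} (s + x) * stay \<mu> (\<lambda>_. {-c..c}) T (s + x)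
       + (indicator (- A) x + ennreal (indicator A x * g x))" for x
  proof (cases "x \<in> A")
    case True
    show ?thesis
    proof (cases "\<bar>s + x\<bar> \<le> c")
      case True
      then have "s + x \<in> {-c..c}" by auto
      with Suc.IH[OF True] \<open>x \<in> A\<close> show ?thesis by (simp add: g_def)
    next
      case False
      then have "c\<^sup>2 \<le> (s + x)\<^sup>2" using c by (simp add: abs_le_square_iff[symmetric])
      also have "\<dots> \<le> (s + x)\<^sup>2 + T * \<sigma>" using \<sigma>0 by simp
      finally have "1 \<le> ((s + x)\<^sup>2 + T * \<sigma>) / c\<^sup>2" using c by simp
      then have "1 \<le> g x" using \<tau>0 by (simp add: g_def add_increasing)
      then have "1 \<le> ennreal (indicator A x * g x)" using \<open>x \<in> A\<close> by simp
      then show ?thesis using \<open>x \<in> A\<close> by (simp add: add_increasing)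
    qed
  qed (auto simp: add_increasing add_increasing2)
  have "1 = (\<integral>\<^sup>+x. 1 \<partial>\<mu>)" using emeasure_space_1 by simp
  also have "\<dots> \<le> (\<integral>\<^sup>+x. indicator {-c..c} (s + x) * stay \<mu> (\<lambda>_. {-c..c}) T (s + x)
       + (indicator (- A) x + ennreal (indicator A x * g x)) \<partial>\<mu>)"
    by (intro nn_integral_mono pw)
  also have "\<dots> = stay \<mu> (\<lambda>_. {-c..c}) (Suc T) s + (emeasure \<mu> (- A) + (\<integral>\<^sup>+x. ennreal (indicator A x * g x) \<partial>\<mu>))"
    by (simp add: nn_integral_add A_def sets_eq)
  also have "emeasure \<mu> (- A) = ennreal \<tau>" by (simp add: \<tau>_def emeasure_eq_measure)
  also have "(\<integral>\<^sup>+x. ennreal (indicator A x * g x) \<partial>\<mu>) = ennreal (\<integral>x. indicator A x * g x \<partial>\<mu>)"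
    by (rule nn_integral_eq_integral[OF ig]) (auto simp: g0)
  also have "stay \<mu> (\<lambda>_. {-c..c}) (Suc T) s + (ennreal \<tau> + ennreal (\<integral>x. indicator A x * g x \<partial>\<mu>))
     \<le> stay \<mu> (\<lambda>_. {-c..c}) (Suc T) s + (ennreal \<tau> + ennreal (T * \<tau> + (s\<^sup>2 + Suc T * \<sigma>) / c\<^sup>2))"
    by (intro add_left_mono ennreal_leI ig_le)
  also have "ennreal \<tau> + ennreal (T * \<tau> + (s\<^sup>2 + Suc T * \<sigma>) / c\<^sup>2) = ennreal (Suc T * \<tau> + (s\<^sup>2 + Suc T * \<sigma>) / c\<^sup>2)"
    using \<tau>0 \<sigma>0 by (subst ennreal_plus[symmetric]) (auto simp: algebra_simps)
  finally show ?case .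
qed simp

text \<open>All three follow from dominated convergence with the integrable bound \<open>\<bar>x\<bar>\<close>: in the first
two because \<open>z \<le> \<bar>x\<bar>\<close> outside and \<open>x\<^sup>2 / z \<le> \<bar>x\<bar>\<close> inside \<open>{-z..z}\<close>.\<close>
lemma truncated_limits:
  shows "((\<lambda>z. z * measure \<mu> (- {-z..z})) \<longlongrightarrow> 0) at_top"
    and "((\<lambda>z. (\<integral>x. indicator {-z..z} x * x\<^sup>2 \<partial>\<mu>) / z) \<longlongrightarrow> 0) at_top"
    and "((\<lambda>z. (\<integral>x. indicator {-z..z} x * x \<partial>\<mu>)) \<longlongrightarrow> 0) at_top"
proof -
  have iabs: "integrable \<mu> (\<lambda>x. \<bar>x\<bar>)" using integrable_id by simp
  have ev: "eventually (\<lambda>z. x \<in> {-z..z}) at_top" for x :: real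
    using eventually_ge_at_top[of "\<bar>x\<bar>"] by eventually_elim auto
  have "((\<lambda>z. \<integral>x. z * indicator (- {-z..z}) x \<partial>\<mu>) \<longlongrightarrow> (\<integral>x. 0 \<partial>\<mu>)) at_top"
  proof (rule integral_dominated_convergence_at_top[OF _ _ iabs])
    show "eventually (\<lambda>z. AE x in \<mu>. norm (z * indicator (- {-z..z}) x) \<le> \<bar>x\<bar>) at_top"
      using eventually_gt_at_top[of 0] by eventually_elim (auto simp: indicator_def intro!: AE_I2)
    show "AE x in \<mu>. ((\<lambda>z. z * indicator (- {-z..z}) x) \<longlongrightarrow> 0) at_top"
    proof (intro AE_I2 tendsto_eventually)
      fix x :: real show "eventually (\<lambda>z. z * indicator (- {-z..z}) x = 0) at_top"
        using ev[of x] by eventually_elim auto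
    qed
  qed measurable
  moreover have "(\<integral>x. z * indicator (- {-z..z}) x \<partial>\<mu>) = z * measure \<mu> (- {-z..z})" for z
    by simp
  ultimately show "((\<lambda>z. z * measure \<mu> (- {-z..z})) \<longlongrightarrow> 0) at_top" by simp
  have "((\<lambda>z. \<integral>x. indicator {-z..z} x * x\<^sup>2 / z \<partial>\<mu>) \<longlongrightarrow> (\<integral>x. 0 \<partial>\<mu>)) at_top"
  proof (rule integral_dominated_convergence_at_top[OF _ _ iabs])
    show "eventually (\<lambda>z. AE x in \<mu>. norm (indicator {-z..z} x * x\<^sup>2 / z) \<le> \<bar>x\<bar>) at_top"
      using eventually_gt_at_top[of 0]
    proof eventually_elim
      case (elim z)
      have "x\<^sup>2 \<le> \<bar>x\<bar> * z" if "x \<in> {-z..z}" for x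
        using that mult_left_mono[of "\<bar>x\<bar>" z "\<bar>x\<bar>"] by (auto simp: power2_eq_square abs_le_iff)
      then show ?case using elim by (auto simp: indicator_def field_simps intro!: AE_I2)
    qed
    show "AE x in \<mu>. ((\<lambda>z. indicator {-z..z} x * x\<^sup>2 / z) \<longlongrightarrow> 0) at_top"
    proof (intro AE_I2)
      fix x :: real
      have "((\<lambda>z. x\<^sup>2 / z) \<longlongrightarrow> 0) at_top"
        by (rule tendsto_divide_0[OF tendsto_const filterlim_at_top_imp_at_infinity[OF filterlim_ident]])
      moreover have "eventually (\<lambda>z. x\<^sup>2 / z = indicator {-z..z} x * x\<^sup>2 / z) at_top"
        using ev[of x] by eventually_elim auto
      ultimately show "((\<lambda>z. indicator {-z..z} x * x\<^sup>2 / z) \<longlongrightarrow> 0) at_top"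
        by (rule Lim_transform_eventually)
    qed
  qed measurable
  then show "((\<lambda>z. (\<integral>x. indicator {-z..z} x * x\<^sup>2 \<partial>\<mu>) / z) \<longlongrightarrow> 0) at_top" by simp
  have "((\<lambda>z. \<integral>x. indicator {-z..z} x * x \<partial>\<mu>) \<longlongrightarrow> (\<integral>x. x \<partial>\<mu>)) at_top"
  proof (rule integral_dominated_convergence_at_top[OF _ _ iabs])
    show "eventually (\<lambda>z. AE x in \<mu>. norm (indicator {-z..z} x * x) \<le> \<bar>x\<bar>) at_top"
      by (intro always_eventually allI AE_I2) (auto simp: indicator_def)
    show "AE x in \<mu>. ((\<lambda>z. indicator {-z..z} x * x) \<longlongrightarrow> x) at_top"
    proof (intro AE_I2 tendsto_eventually)
      fix x :: real show "eventually (\<lambda>z. indicator {-z..z} x * x = x) at_top"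
        using ev[of x] by eventually_elim auto
    qed
  qed measurable
  then show "((\<lambda>z. (\<integral>x. indicator {-z..z} x * x \<partial>\<mu>)) \<longlongrightarrow> 0) at_top" by (simp add: mean_0)
qed

text \<open>The weak law of large numbers in maximal form, from the variance bound with truncation at \<open>z\<close>.\<close>
lemma stay_near_start:
  assumes "\<eta> > 0" "C > 0"
  shows "eventually (\<lambda>z. \<forall>T::nat. real T \<le> C * z \<longrightarrow>
     ennreal (1/2) \<le> stay \<mu> (\<lambda>_. {- (\<eta> * z)..\<eta> * z}) T 0) at_top"
proof -
  define r where "r z = C * (z * measure \<mu> (- {-z..z})) + C / \<eta>\<^sup>2 * ((\<integral>x. indicator {-z..z} x * x\<^sup>2 \<partial>\<mu>) / z)
     + 2 * C / \<eta> * \<bar>\<integral>x. indicator {-z..z} x * x \<partial>\<mu>\<bar>" for z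
  have "(r \<longlongrightarrow> C * 0 + C / \<eta>\<^sup>2 * 0 + 2 * C / \<eta> * \<bar>0\<bar>) at_top"
    unfolding r_def by (intro tendsto_intros truncated_limits)
  then have "eventually (\<lambda>z. r z < 1/2) at_top"
    by (intro order_tendstoD) auto
  with eventually_gt_at_top[of 0] show ?thesis
  proof eventually_elim
    case (elim z)
    define \<tau> where "\<tau> = measure \<mu> (- {-z..z})"
    define v where "v = (\<integral>x. indicator {-z..z} x * x\<^sup>2 \<partial>\<mu>)"
    define e where "e = \<bar>\<integral>x. indicator {-z..z} x * x \<partial>\<mu>\<bar>"
    have nn: "\<tau> \<ge> 0" "v \<ge> 0" "e \<ge> 0"
      by (auto simp: \<tau>_def v_def e_def intro!: integral_nonneg_AE)
    show ?case
    proof (intro allI impI)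
      fix T :: nat assume T: "real T \<le> C * z"
      let ?V = "stay \<mu> (\<lambda>_. {- (\<eta> * z)..\<eta> * z}) T 0"
      let ?q = "T * \<tau> + (0\<^sup>2 + T * (v + 2 * (\<eta> * z) * e)) / (\<eta> * z)\<^sup>2"
      have "1 \<le> ?V + ennreal ?q"
        unfolding \<tau>_def v_def e_def using assms elim
        by (intro stay_interval_ge_variance) auto
      moreover have "?q \<le> (C * z) * \<tau> + (0\<^sup>2 + (C * z) * (v + 2 * (\<eta> * z) * e)) / (\<eta> * z)\<^sup>2"
        using T nn elim assms
        by (intro add_mono mult_right_mono divide_right_mono) auto
      moreover have "\<dots> = r z"
        unfolding r_def \<tau>_def[symmetric] v_def[symmetric] e_def[symmetric]
        using elim assms by (simp add: field_simps power2_eq_square)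
      ultimately have "?q \<le> 1/2" using elim by linarith
      then have "?V + ennreal ?q \<le> ?V + ennreal (1/2)"
        by (intro add_left_mono ennreal_leI)
      with \<open>1 \<le> ?V + ennreal ?q\<close> have "1 \<le> ?V + ennreal (1/2)" by (rule order_trans)
      moreover obtain w where w: "?V = ennreal w" "w \<ge> 0"
        using stay_le_1[of "\<lambda>_. {- (\<eta> * z)..\<eta> * z}" T 0] by (cases ?V) (auto simp: top_unique)
      ultimately have "ennreal 1 \<le> ennreal (w + 1/2)"
        by (simp add: ennreal_plus)
      then have "1/2 \<le> w" using w by (subst (asm) ennreal_le_iff) auto
      then show "ennreal (1/2) \<le> ?V"
        unfolding w(1) by (rule ennreal_leI)
    qed
  qed
qed

text \<open>Suppose that one of the first \<open>k\<close> steps is a jump in \<open>{d1<..d2}\<close>, while the path without this step stays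
in \<open>{-c..c}\<close>. By independence each position of the jump contributes the jump probability times
the probability that a path with one step fewer stays in \<open>{-c..c}\<close>, and the contributions add up because a jump exceeds the
width \<open>2 c\<close>, so that only one step can be the jump.\<close>
lemma stay_one_jump_ge:
  fixes c d1 d2 :: real
  assumes c: "c > 0" and d: "d1 \<le> d2" "2 * c \<le> d1"
    and "k \<le> T" "\<bar>s\<bar> \<le> c"
  shows "stay \<mu> (\<lambda>i. if i < k then {-c..d2 + c} else {d1 - c..d2 + c}) T s \<ge>
    of_nat k * emeasure \<mu> {d1<..d2} * stay \<mu> (\<lambda>_. {-c..c}) (T - 1) s"
  using assms(4-)
proof (induction k arbitrary: T s)
  case (Suc k)
  then obtain T' where T: "T = Suc T'" and "k \<le> T'" by (cases T) auto
  let ?D = "\<lambda>k i. if i < k then {-c..d2 + c} else {d1 - c..d2 + c}"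
  let ?V = "stay \<mu> (\<lambda>_. {-c..c})"
  let ?B = "{d1<..d2}"
  have s_shift: "(\<lambda>i. ?D (Suc k) (Suc i)) = ?D k" by auto
  have [measurable]: "?V n \<in> borel_measurable borel" for n by (rule measurable_stay) auto
  have [measurable]: "?B \<in> sets \<mu>" by (auto simp: sets_eq)
  \<comment> \<open>After the jump the remaining path is a translate of a path that stays in \<open>{-c..c}\<close>.\<close>
  have jump: "?V T' s \<le> stay \<mu> (?D k) T' (s + x)" if "x \<in> ?B" for x
    using that d by (intro stay_translate_le) auto
  \<comment> \<open>The two summands, no jump at this step and jump at this step, never contribute for the same \<open>x\<close>.\<close>
  have pw: "of_nat k * emeasure \<mu> ?B * (indicator {-c..c} (s + x) * ?V (T' - 1) (s + x)) + indicator ?B x * ?V T' s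
      \<le> indicator (?D (Suc k) 0) (s + x) * stay \<mu> (?D k) T' (s + x)" for x
  proof (cases "x \<in> ?B")
    case True
    then have "s + x \<notin> {-c..c}" "s + x \<in> {-c..d2 + c}" using Suc.prems d c by auto
    then show ?thesis using jump[OF True] True by simp
  next
    case False
    show ?thesis
    proof (cases "s + x \<in> {-c..c}")
      case True
      then have "s + x \<in> {-c..d2 + c}" using d c by auto
      moreover have "of_nat k * emeasure \<mu> ?B * ?V (T' - 1) (s + x) \<le> stay \<mu> (?D k) T' (s + x)"
        using True \<open>k \<le> T'\<close> by (intro Suc.IH) auto
      ultimately show ?thesis using False True by simp
    qed (use False in simp)
  qed
  have "of_nat (Suc k) * emeasure \<mu> ?B * ?V T' s = of_nat k * emeasure \<mu> ?B * ?V T' s + ?V T' s * emeasure \<mu> ?B"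
    by (simp add: algebra_simps)
  also have "\<dots> = of_nat k * emeasure \<mu> ?B * (\<integral>\<^sup>+x. indicator {-c..c} (s + x) * ?V (T' - 1) (s + x) \<partial>\<mu>) + ?V T' s * emeasure \<mu> ?B"
  proof (cases "k = 0")
    case False
    then obtain T'' where "T' = Suc T''" using \<open>k \<le> T'\<close> by (cases T') auto
    then show ?thesis by simp
  qed simp
  also have "\<dots> = (\<integral>\<^sup>+x. of_nat k * emeasure \<mu> ?B * (indicator {-c..c} (s + x) * ?V (T' - 1) (s + x)) + ?V T' s * indicator ?B x \<partial>\<mu>)"
    by (subst nn_integral_add, measurable) (simp add: nn_integral_cmult nn_integral_cmult_indicator)
  also have "\<dots> \<le> (\<integral>\<^sup>+x. indicator (?D (Suc k) 0) (s + x) * stay \<mu> (?D k) T' (s + x) \<partial>\<mu>)"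
    using pw by (intro nn_integral_mono) (simp add: mult.commute)
  also have "\<dots> = stay \<mu> (?D (Suc k)) T s"
    unfolding T stay.simps s_shift ..
  finally show ?case by (simp add: T)
qed simp

end

section \<open>Large deviations\<close>

lemma exp_le_quadratic:
  fixes u :: real
  assumes "u \<le> 1"
  shows "exp u \<le> 1 + u + min \<bar>u\<bar> (u\<^sup>2)"
proof (cases "u \<ge> 0")
  case True
  then have "u\<^sup>2 \<le> u" using assms by (simp add: power2_eq_square mult_left_le)
  then show ?thesis using exp_bound[of u] True assms by (simp add: min_def)
next
  case False
  then have u: "u < 0" by simp
  have "exp u = 1 / exp (- u)" by (simp add: exp_minus inverse_eq_divide)
  also have "\<dots> \<le> 1 / (1 - u)"
    using u exp_ge_add_one_self[of "- u"] by (intro divide_left_mono) auto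
  also have "\<dots> \<le> 1 + u + u\<^sup>2"
  proof -
    have "(1 + u + u\<^sup>2) * (1 - u) = 1 - u ^ 3" by (simp add: algebra_simps power2_eq_square power3_eq_cube)
    moreover have "u ^ 3 \<le> 0" using u by (simp add: power3_eq_cube mult_nonneg_nonpos2 mult_nonpos_nonpos mult_nonneg_nonpos)
    ultimately show ?thesis using u by (simp add: divide_le_eq)
  qed
  finally have "exp u \<le> 1 + u + u\<^sup>2" .
  moreover have "exp u \<le> 1" using u by simp
  ultimately show ?thesis using u by (simp add: min_def)
qed

context heavy_tailed_walk begin

text \<open>Chernoff's bound after truncation: either one of the \<open>T\<close> steps exceeds \<open>y\<close>, or the walk gains \<open>Y - s\<close>
with steps of size at most \<open>y\<close>, to which the exponential Markov inequality applies.\<close>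
lemma stay_le_truncated_exp_moment:
  fixes l y Y s :: real
  defines "\<phi> \<equiv> \<integral>\<^sup>+x. indicator {..y} x * ennreal (exp (l * x)) \<partial>\<mu>"
  assumes "T = 0 \<Longrightarrow> Y \<le> s" "T > 0 \<Longrightarrow> D (T - 1) \<subseteq> {Y..}" and l: "l \<ge> 0"
  shows "stay \<mu> D T s \<le> of_nat T * ennreal (G y) + ennreal (exp (- l * (Y - s))) * \<phi> ^ T"
  using assms(2,3)
proof (induction T arbitrary: D s)
  case 0
  then have "ennreal 1 \<le> ennreal (exp (- l * (Y - s)))"
    using l by (intro ennreal_leI) (simp add: mult_nonneg_nonpos)
  then show ?case by simp
next
  case (Suc T)
  let ?D = "\<lambda>k. D (Suc k)"
  let ?B = "\<lambda>s. of_nat T * ennreal (G y) + ennreal (exp (- l * (Y - s))) * \<phi> ^ T"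
  have [measurable]: "{..y} \<in> sets \<mu>" "{y<..} \<in> sets \<mu>" by (auto simp: sets_eq)
  have G: "emeasure \<mu> {y<..} = ennreal (G y)" by (simp add: emeasure_eq_measure)
  have pw: "indicator (D 0) (s + x) * stay \<mu> ?D T (s + x) \<le>
      indicator {y<..} x + (of_nat T * ennreal (G y) * indicator {..y} x
        + ennreal (exp (- l * (Y - s))) * \<phi> ^ T * (indicator {..y} x * ennreal (exp (l * x))))" for x
  proof (cases "s + x \<in> D 0")
    case True
    show ?thesis
    proof (cases "x \<le> y")
      case True
      have "stay \<mu> ?D T (s + x) \<le> ?B (s + x)"
      proof (rule Suc.IH)
        show "T = 0 \<Longrightarrow> Y \<le> s + x" using Suc.prems \<open>s + x \<in> D 0\<close> by auto
        show "0 < T \<Longrightarrow> D (Suc (T - 1)) \<subseteq> {Y..}" using Suc.prems by simp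
      qed
      moreover have "exp (- l * (Y - (s + x))) = exp (- l * (Y - s)) * exp (l * x)"
        by (simp add: exp_add[symmetric] algebra_simps)
      ultimately show ?thesis using True \<open>s + x \<in> D 0\<close> by (simp add: ennreal_mult mult_ac)
    next
      case False
      have "stay \<mu> ?D T (s + x) \<le> 1" by (rule stay_le_1)
      then show ?thesis using False \<open>s + x \<in> D 0\<close> by simp
    qed
  qed simp
  have "stay \<mu> D (Suc T) s \<le> (\<integral>\<^sup>+x. indicator {y<..} x + (of_nat T * ennreal (G y) * indicator {..y} x
        + ennreal (exp (- l * (Y - s))) * \<phi> ^ T * (indicator {..y} x * ennreal (exp (l * x)))) \<partial>\<mu>)"
    unfolding stay.simps by (intro nn_integral_mono pw)
  also have "\<dots> = ennreal (G y) + (of_nat T * ennreal (G y) * emeasure \<mu> {..y} + ennreal (exp (- l * (Y - s))) * \<phi> ^ T * \<phi>)"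
    by (simp add: nn_integral_add nn_integral_cmult nn_integral_cmult_indicator G \<phi>_def)
  also have "\<dots> \<le> ennreal (G y) + (of_nat T * ennreal (G y) * 1 + ennreal (exp (- l * (Y - s))) * \<phi> ^ T * \<phi>)"
    by (intro add_mono mult_left_mono order_refl) (auto simp: emeasure_le_1)
  also have "\<dots> = of_nat (Suc T) * ennreal (G y) + ennreal (exp (- l * (Y - s))) * \<phi> ^ Suc T"
    by (simp add: algebra_simps)
  finally show ?case .
qed

text \<open>A bound for the second-order remainder of the exponential moment over \<open>{..1 / l}\<close>, divided by \<open>l\<close>. Integrability of the steps
makes it vanish as \<open>l \<longrightarrow> 0\<close>.\<close>
definition \<kappa> :: "real \<Rightarrow> real" where "\<kappa> l = (\<integral>x. min \<bar>x\<bar> (l * x\<^sup>2) \<partial>\<mu>)"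

text \<open>The exponential is compared with its linear part, whose integral is one because the walk is centred.
On \<open>x \<le> 1 / l\<close> the error is quadratic for small and linear for large negative arguments, so that its
integral is of smaller order than \<open>l\<close>; on \<open>{1 / l<..y}\<close> the exponential is bounded by its value at \<open>y\<close>.\<close>
lemma truncated_exp_moment_le:
  assumes l: "l > 0" and y: "y > 0"
  shows "(\<integral>\<^sup>+x. indicator {..y} x * ennreal (exp (l * x)) \<partial>\<mu>)
     \<le> ennreal (1 + (l * \<kappa> l + exp (l * y) * G (1 / l)))"
proof -
  define h where "h x = (1 + l * x) + (l * min \<bar>x\<bar> (l * x\<^sup>2) + exp (l * y) * indicator {1 / l<..} x)" for x
  have pw: "indicator {..y} x * exp (l * x) \<le> h x" for x
  proof -
    have mn: "0 \<le> l * min \<bar>x\<bar> (l * x\<^sup>2)" using l by simp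
    show ?thesis
    proof (cases "x \<le> 1 / l")
      case True
      then have "l * x \<le> 1" using l by (simp add: field_simps)
      from exp_le_quadratic[OF this]
      have "exp (l * x) \<le> 1 + l * x + min \<bar>l * x\<bar> ((l * x)\<^sup>2)" .
      also have "min \<bar>l * x\<bar> ((l * x)\<^sup>2) = l * min \<bar>x\<bar> (l * x\<^sup>2)"
        using l by (simp add: abs_mult power2_eq_square min_def mult_ac)
      finally have "exp (l * x) \<le> h x" using True by (simp add: h_def)
      moreover from this have "0 \<le> h x" by (meson exp_ge_zero order_trans)
      ultimately show ?thesis by (simp add: indicator_def)
    next
      case False
      then have "x > 0" using l by (meson divide_pos_pos not_le order_less_trans zero_less_one)
      have "indicator {..y} x * exp (l * x) \<le> exp (l * y)"
        using l by (auto simp: indicator_def)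
      also have "\<dots> \<le> h x"
        using False \<open>x > 0\<close> l mn by (simp add: h_def)
      finally show ?thesis .
    qed
  qed
  have imin: "integrable \<mu> (\<lambda>x. min \<bar>x\<bar> (l * x\<^sup>2))"
    by (rule Bochner_Integration.integrable_bound[OF integrable_id]) (use l in auto)
  have iind: "integrable \<mu> (\<lambda>x. indicator {1 / l<..} x :: real)"
    by (auto simp: sets_eq emeasure_eq_measure)
  have ih: "integrable \<mu> h"
    unfolding h_def using imin iind integrable_id by auto
  have "(\<integral>x. h x \<partial>\<mu>) = 1 + (l * \<kappa> l + exp (l * y) * G (1 / l))"
    unfolding h_def \<kappa>_def using imin iind integrable_id
    by (simp add: mean_0 prob_space[unfolded space_eq])
  moreover have "(\<integral>\<^sup>+x. indicator {..y} x * ennreal (exp (l * x)) \<partial>\<mu>) \<le> (\<integral>\<^sup>+x. ennreal (h x) \<partial>\<mu>)"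
  proof (intro nn_integral_mono)
    fix x show "indicator {..y} x * ennreal (exp (l * x)) \<le> ennreal (h x)"
      using ennreal_leI[OF pw[of x]] by (cases "x \<le> y") auto
  qed
  moreover have "0 \<le> h x" for x
    using pw[of x] by (meson exp_ge_zero indicator_pos_le mult_nonneg_nonneg order_trans)
  ultimately show ?thesis using nn_integral_eq_integral[OF ih] by simp
qed

lemma tendsto_\<kappa>:
  assumes l: "(l \<longlongrightarrow> 0) at_top" and nn: "eventually (\<lambda>z::real. l z \<ge> 0) at_top"
  shows "((\<lambda>z. \<kappa> (l z)) \<longlongrightarrow> 0) at_top"
proof -
  have iabs: "integrable \<mu> (\<lambda>x. \<bar>x\<bar>)" using integrable_id by simp
  have "((\<lambda>z. \<integral>x. min \<bar>x\<bar> (l z * x\<^sup>2) \<partial>\<mu>) \<longlongrightarrow> (\<integral>x. 0 \<partial>\<mu>)) at_top"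
  proof (rule integral_dominated_convergence_at_top[OF _ _ iabs])
    show "eventually (\<lambda>z. AE x in \<mu>. norm (min \<bar>x\<bar> (l z * x\<^sup>2)) \<le> \<bar>x\<bar>) at_top"
      using nn by eventually_elim (auto intro!: AE_I2)
    show "AE x in \<mu>. ((\<lambda>z. min \<bar>x\<bar> (l z * x\<^sup>2)) \<longlongrightarrow> 0) at_top"
    proof (intro AE_I2)
      fix x
      have "((\<lambda>z. min \<bar>x\<bar> (l z * x\<^sup>2)) \<longlongrightarrow> min \<bar>x\<bar> (0 * x\<^sup>2)) at_top"
        by (intro tendsto_intros l)
      then show "((\<lambda>z. min \<bar>x\<bar> (l z * x\<^sup>2)) \<longlongrightarrow> 0) at_top" by simp
    qed
  qed measurable
  then show ?thesis by (simp add: \<kappa>_def)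
qed

text \<open>Over a number of steps proportional to \<open>z\<close>, a gain of order \<open>z\<close> costs no more than a single
big jump at one of these steps, up to a power \<open>z powr \<delta>\<close>. The truncation level is \<open>\<theta> z\<close>: exceeding it is the
big jump. Without a big jump the exponential parameter \<open>l z = K ln z / z\<close> turns the gain \<open>c z\<close> into the factor
\<open>z powr - \<alpha>\<close>, which is smaller than needed by a full power of \<open>z\<close>; this power is what the \<open>T\<close>-fold product of
exponential moments may consume.\<close>
lemma large_deviation_bound:
  assumes c: "c > 0" and C: "C > 0" and \<delta>: "0 < \<delta>" "\<delta> < 1"
  shows "eventually (\<lambda>z. \<forall>(T::nat) D Y s. 0 < T \<longrightarrow> real T \<le> C * z \<longrightarrow> D (T - 1) \<subseteq> {Y..} \<longrightarrow>
     c * z \<le> Y - s \<longrightarrow> stay \<mu> D T s \<le> ennreal (z powr (- (\<alpha> - 1) + \<delta>))) at_top"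
proof -
  define \<beta> where "\<beta> = (\<alpha> - 1) / 4"
  have \<beta>: "\<beta> > 0" "\<alpha> = 1 + 4 * \<beta>" using \<alpha> by (auto simp: \<beta>_def field_simps)
  \<comment> \<open>\<open>K\<close> makes the exponential factor \<open>exp (- l z * c z)\<close> equal to \<open>z powr - \<alpha>\<close>, and \<open>\<theta>\<close> makes \<open>exp (l z * \<theta> z)\<close> equal to \<open>z powr (2 * \<beta>)\<close>, which the tail beyond \<open>1 / l z\<close> compensates.\<close>
  define K where "K = \<alpha> / c"
  have K: "K > 0" using c \<alpha> by (simp add: K_def)
  define \<theta> where "\<theta> = 2 * \<beta> / K"
  have \<theta>: "\<theta> > 0" using \<beta> K by (simp add: \<theta>_def)
  define l where "l z = K * ln z / z" for z :: real
  have l0: "(l \<longlongrightarrow> 0) at_top" unfolding l_def using K by real_asymp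
  have linv: "filterlim (\<lambda>z. 1 / l z) at_top at_top" unfolding l_def using K by real_asymp
  have e1: "eventually (\<lambda>z::real. z > exp 1) at_top" by (rule eventually_gt_at_top)
  then have lpos: "eventually (\<lambda>z. l z \<ge> 0) at_top"
  proof eventually_elim
    case (elim z)
    then have "z > 1" by (meson exp_ge_add_one_self less_trans one_less_exp_iff zero_less_one)
    then show ?case using K by (simp add: l_def)
  qed
  have "((\<lambda>z. C * K * \<kappa> (l z)) \<longlongrightarrow> C * K * 0) at_top"
    by (intro tendsto_intros tendsto_\<kappa> l0 lpos)
  then have e2: "eventually (\<lambda>z. C * K * \<kappa> (l z) < 1/2) at_top"
    by (rule order_tendstoD) simp
  have "eventually (\<lambda>x. G x \<le> x powr (- \<alpha> + \<beta>)) at_top"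
    using \<beta> by (intro tail_le_powr) auto
  then have e3: "eventually (\<lambda>z. G (1 / l z) \<le> (1 / l z) powr (- \<alpha> + \<beta>)) at_top"
    using linv by (rule eventually_compose_filterlim)
  have "((\<lambda>z. C * z powr (1 + 2 * \<beta>) * (1 / (K * ln z / z)) powr (- 1 - 3 * \<beta>)) \<longlongrightarrow> 0) at_top"
    using \<beta>(1) K C by real_asymp
  then have e4: "eventually (\<lambda>z. C * z powr (1 + 2 * \<beta>) * (1 / l z) powr (- 1 - 3 * \<beta>) < 1/2) at_top"
    unfolding l_def by (rule order_tendstoD) simp
  have "filterlim (\<lambda>z. \<theta> * z) at_top at_top" using \<theta> by real_asymp
  moreover have "eventually (\<lambda>x. G x \<le> x powr (- \<alpha> + \<delta> / 2)) at_top"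
    using \<delta> \<alpha> by (intro tail_le_powr) auto
  ultimately have e5: "eventually (\<lambda>z. G (\<theta> * z) \<le> (\<theta> * z) powr (- \<alpha> + \<delta> / 2)) at_top"
    by (rule eventually_compose_filterlim[rotated])
  have "filterlim (\<lambda>z::real. z powr (\<delta> / 2)) at_top at_top" using \<delta> by real_asymp
  then have e6: "eventually (\<lambda>z. 2 * C * \<theta> powr (- \<alpha> + \<delta> / 2) \<le> z powr (\<delta> / 2)) at_top"
    by (simp add: filterlim_at_top)
  have "filterlim (\<lambda>z::real. z powr \<delta>) at_top at_top" using \<delta> by real_asymp
  then have e7: "eventually (\<lambda>z::real. 2 \<le> z powr \<delta>) at_top"
    by (simp add: filterlim_at_top)
  from e1 lpos e2 e3 e4 e5 e6 e7 show ?thesis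
  proof eventually_elim
    case (elim z)
    have z: "z > 0" using elim(1) by (meson exp_gt_zero less_trans)
    have lnz: "ln z > 1" using elim(1) z ln_less_cancel_iff[of "exp 1" z] by simp
    have lz: "l z > 0"
    proof -
      have "K * ln z > 0" using lnz K by (intro mult_pos_pos) linarith+
      then show ?thesis unfolding l_def using z by (rule divide_pos_pos)
    qed
    define \<psi> where "\<psi> = l z * \<kappa> (l z) + exp (l z * (\<theta> * z)) * G (1 / l z)"
    have \<kappa>0: "\<kappa> (l z) \<ge> 0" unfolding \<kappa>_def using lz by (intro integral_nonneg_AE) auto
    have \<psi>0: "\<psi> \<ge> 0" using \<kappa>0 lz by (simp add: \<psi>_def)
    \<comment> \<open>The product of the exponential moments over all steps is at most \<open>exp (C z \<psi>)\<close>, hence at most \<open>z\<close>.\<close>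
    have "C * z * \<psi> \<le> ln z"
    proof -
      have "exp (l z * (\<theta> * z)) = z powr (2 * \<beta>)"
        using z K by (simp add: l_def \<theta>_def powr_def)
      then have "C * z * (exp (l z * (\<theta> * z)) * G (1 / l z)) = C * z powr (1 + 2 * \<beta>) * G (1 / l z)"
        using z by (simp add: powr_add)
      also have "\<dots> \<le> C * z powr (1 + 2 * \<beta>) * (1 / l z) powr (- 1 - 3 * \<beta>)"
      proof -
        have "- \<alpha> + \<beta> = - 1 - 3 * \<beta>" using \<beta>(2) by simp
        from elim(4)[unfolded this] show ?thesis by (rule mult_left_mono) (use C in simp)
      qed
      also have "\<dots> \<le> 1 / 2" using elim by simp
      finally have "C * z * (exp (l z * (\<theta> * z)) * G (1 / l z)) \<le> 1 / 2" .
      moreover have "C * z * (l z * \<kappa> (l z)) \<le> (1 / 2) * ln z"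
      proof -
        have "C * z * (l z * \<kappa> (l z)) = (C * K * \<kappa> (l z)) * ln z" using z by (simp add: l_def)
        also have "\<dots> \<le> (1 / 2) * ln z" using elim(3) lnz by (intro mult_right_mono) auto
        finally show ?thesis .
      qed
      ultimately show ?thesis using lnz by (simp add: \<psi>_def distrib_left)
    qed
    show ?case
    proof (intro allI impI)
      fix T :: nat and D and Y s :: real
      assume T: "0 < T" "real T \<le> C * z" and D: "D (T - 1) \<subseteq> {Y..}" and Y: "c * z \<le> Y - s"
      define \<phi> where "\<phi> = (\<integral>\<^sup>+x. indicator {..\<theta> * z} x * ennreal (exp (l z * x)) \<partial>\<mu>)"
      have "\<phi> \<le> ennreal (1 + \<psi>)"
        unfolding \<phi>_def \<psi>_def using lz \<theta> z by (intro truncated_exp_moment_le) auto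
      also have "\<dots> \<le> ennreal (exp \<psi>)" by (intro ennreal_leI exp_ge_add_one_self)
      finally have "\<phi> ^ T \<le> ennreal (exp \<psi>) ^ T" by (rule power_mono) simp
      also have "\<dots> = ennreal (exp (T * \<psi>))" by (simp add: ennreal_power exp_of_nat_mult)
      also have "\<dots> \<le> ennreal z"
      proof -
        have "T * \<psi> \<le> C * z * \<psi>" using T \<psi>0 by (intro mult_right_mono) auto
        also have "\<dots> \<le> ln z" by fact
        finally have "exp (T * \<psi>) \<le> z" using z by (metis exp_le_cancel_iff exp_ln)
        then show ?thesis by (rule ennreal_leI)
      qed
      finally have \<phi>: "\<phi> ^ T \<le> ennreal z" .
      have "exp (- l z * (Y - s)) \<le> z powr - \<alpha>"
      proof -
        have "l z * (c * z) \<le> l z * (Y - s)" using lz Y by (intro mult_left_mono) auto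
        moreover have "l z * (c * z) = \<alpha> * ln z" using z c by (simp add: l_def K_def)
        ultimately show ?thesis using z by (simp add: powr_def)
      qed
      then have E: "ennreal (exp (- l z * (Y - s))) * \<phi> ^ T \<le> ennreal (z powr - \<alpha>) * ennreal z"
        using \<phi> by (intro mult_mono ennreal_leI) auto
      have "z powr - \<alpha> * z = z powr (- (\<alpha> - 1))"
        using z by (simp add: powr_diff powr_minus field_simps powr_add)
      also have "\<dots> \<le> z powr (- (\<alpha> - 1)) * (z powr \<delta> / 2)"
        using mult_left_mono[OF elim(8), of "z powr (- (\<alpha> - 1))"] by simp
      also have "\<dots> = z powr (- (\<alpha> - 1) + \<delta>) / 2" by (simp add: powr_add)
      finally have E2: "z powr - \<alpha> * z \<le> z powr (- (\<alpha> - 1) + \<delta>) / 2" .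
      have "T * G (\<theta> * z) \<le> (C * z) * (\<theta> * z) powr (- \<alpha> + \<delta> / 2)"
        using T elim(6) C z by (intro mult_mono) auto
      also have "\<dots> = (2 * C * \<theta> powr (- \<alpha> + \<delta> / 2)) * (z * z powr (- \<alpha> + \<delta> / 2)) / 2"
        using z \<theta> by (simp add: powr_mult)
      also have "\<dots> \<le> z powr (\<delta> / 2) * (z * z powr (- \<alpha> + \<delta> / 2)) / 2"
        using elim(7) z by (intro divide_right_mono mult_right_mono) auto
      also have "\<dots> = z powr (\<delta> / 2 + (1 + (- \<alpha> + \<delta> / 2))) / 2"
        using z by (simp only: powr_add) simp
      also have "\<delta> / 2 + (1 + (- \<alpha> + \<delta> / 2)) = - (\<alpha> - 1) + \<delta>" by simp
      finally have G2: "T * G (\<theta> * z) \<le> z powr (- (\<alpha> - 1) + \<delta>) / 2" .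
      have "stay \<mu> D T s \<le> of_nat T * ennreal (G (\<theta> * z)) + ennreal (exp (- l z * (Y - s))) * \<phi> ^ T"
        unfolding \<phi>_def using T D lz by (intro stay_le_truncated_exp_moment) auto
      also have "\<dots> \<le> ennreal (T * G (\<theta> * z)) + ennreal (z powr - \<alpha> * z)"
        using E z by (intro add_mono) (auto simp: ennreal_mult' ennreal_of_nat_eq_real_of_nat ennreal_mult)
      also have "\<dots> = ennreal (T * G (\<theta> * z) + z powr - \<alpha> * z)"
        using z by (simp add: ennreal_plus)
      also have "\<dots> \<le> ennreal (z powr (- (\<alpha> - 1) + \<delta>))"
        using G2 E2 by (intro ennreal_leI) linarith
      finally show "stay \<mu> D T s \<le> ennreal (z powr (- (\<alpha> - 1) + \<delta>))" .
    qed
  qed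
qed

end

section \<open>Upper bound for the cone probability\<close>

text \<open>The section of the cone at time \<open>k + 1\<close>, in accordance with the indexing of \<^const>\<open>stay\<close>.\<close>
definition cone_section :: "real \<Rightarrow> real \<Rightarrow> nat \<Rightarrow> real set" where
  "cone_section a b k = {a * real (Suc k)..b * real (Suc k)}"

lemma cone_section_borel [measurable]: "cone_section a b k \<in> sets borel"
  by (simp add: cone_section_def)

lemma sum_real_atLeastLessThan:
  "m \<le> n \<Longrightarrow> (\<Sum>l=m..<n. real l) = (real n * (real n - 1) - real m * (real m - 1)) / 2"
  by (induction n rule: dec_induct) (auto simp: field_simps)

definition geom_time :: "real \<Rightarrow> nat \<Rightarrow> nat" where
  "geom_time \<rho> j = nat \<lfloor>\<rho> ^ j\<rfloor>"

lemma geom_time_bounds: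
  assumes "\<rho> > 1"
  shows "real (geom_time \<rho> j) \<le> \<rho> ^ j" "\<rho> ^ j < real (geom_time \<rho> j) + 1" "geom_time \<rho> j > 0"
proof -
  have "\<rho> ^ j \<ge> 1" using assms by simp
  then have *: "\<lfloor>\<rho> ^ j\<rfloor> \<ge> 1" by linarith
  then have "real (geom_time \<rho> j) = of_int \<lfloor>\<rho> ^ j\<rfloor>" by (simp add: geom_time_def)
  then show "real (geom_time \<rho> j) \<le> \<rho> ^ j" "\<rho> ^ j < real (geom_time \<rho> j) + 1" by linarith+
  show "geom_time \<rho> j > 0" using * by (simp add: geom_time_def)
qed

lemma geom_time_mono: "\<rho> > 1 \<Longrightarrow> i \<le> j \<Longrightarrow> geom_time \<rho> i \<le> geom_time \<rho> j"
  by (auto simp: geom_time_def intro!: nat_mono floor_mono power_increasing)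

context heavy_tailed_walk begin

text \<open>Between the times \<open>\<rho> ^ j\<close> and \<open>\<rho> ^ Suc j\<close> a path in the cone climbs from below \<open>b \<rho> ^ j\<close> to above
\<open>a \<rho> ^ Suc j\<close>, which is a gain of order \<open>\<rho> ^ j\<close> because \<open>a \<rho> > b\<close>. The large deviation bounds of the
windows multiply by the Markov property. Windows before \<open>j0\<close> are discarded.\<close>
lemma stay_cone_geom_time_le:
  assumes a: "0 < a" "a < b" and \<rho>: "\<rho> > b / a" and \<delta>: "0 < \<delta>" "\<delta> < 1"
  shows "\<exists>j0. \<forall>J\<ge>j0. stay \<mu> (cone_section a b) (geom_time \<rho> J) 0
           \<le> ennreal (\<rho> powr (- (\<alpha> - 1 - \<delta>) * (\<Sum>l=j0..<J. real l)))"
proof -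
  define c where "c = (a * \<rho> - b) / 2"
  define \<gamma> where "\<gamma> = \<alpha> - 1 - \<delta>"
  have c: "c > 0" using \<rho> a by (simp add: c_def field_simps)
  have "1 < b / a" using a by simp
  then have \<rho>1: "\<rho> > 1" using \<rho> by linarith
  note sb = geom_time_bounds[OF \<rho>1]
  have lim: "filterlim (\<lambda>j::nat. \<rho> ^ j) at_top sequentially" using \<rho>1 by real_asymp
  have "eventually (\<lambda>z. a \<le> c * z \<and> 2 \<le> (\<rho> - 1) * z) at_top"
    using c \<rho>1 by (intro eventually_conj) (real_asymp)+
  from eventually_conj[OF large_deviation_bound[OF c, of \<rho> \<delta>] this] \<rho>1 \<delta>
  have "eventually (\<lambda>z. (\<forall>(T::nat) D Y s. 0 < T \<longrightarrow> real T \<le> \<rho> * z \<longrightarrow> D (T - 1) \<subseteq> {Y..} \<longrightarrow>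
     c * z \<le> Y - s \<longrightarrow> stay \<mu> D T s \<le> ennreal (z powr (- (\<alpha> - 1) + \<delta>))) \<and> a \<le> c * z \<and> 2 \<le> (\<rho> - 1) * z) at_top"
    by simp
  from eventually_compose_filterlim[OF this lim] obtain j0 where
    j0: "\<And>j (T::nat) D Y s. j \<ge> j0 \<Longrightarrow> 0 < T \<Longrightarrow> real T \<le> \<rho> * \<rho> ^ j \<Longrightarrow> D (T - 1) \<subseteq> {Y..} \<Longrightarrow>
     c * \<rho> ^ j \<le> Y - s \<Longrightarrow> stay \<mu> D T s \<le> ennreal ((\<rho> ^ j) powr (- (\<alpha> - 1) + \<delta>))"
    and j0': "\<And>j. j \<ge> j0 \<Longrightarrow> a \<le> c * \<rho> ^ j \<and> 2 \<le> (\<rho> - 1) * \<rho> ^ j"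
    unfolding eventually_sequentially by blast
  \<comment> \<open>Induction on the number \<open>d\<close> of windows, from the last window backwards.\<close>
  have main: "stay \<mu> (\<lambda>k. cone_section a b (geom_time \<rho> j + k)) (geom_time \<rho> (j + d) - geom_time \<rho> j) s
       \<le> ennreal (\<rho> powr (- \<gamma> * (\<Sum>l=j..<j + d. real l)))"
    if "j \<ge> j0" "s \<le> b * real (geom_time \<rho> j)" for j d s
    using that
  proof (induction d arbitrary: j s)
    case 0
    then show ?case using \<rho>1 by simp
  next
    case (Suc d)
    define T where "T = geom_time \<rho> (Suc j) - geom_time \<rho> j"
    have "2 \<le> (\<rho> - 1) * \<rho> ^ j" using j0' Suc.prems by auto
    then have "real (geom_time \<rho> j) < real (geom_time \<rho> (Suc j))"
      using sb(1)[of j] sb(2)[of "Suc j"] by (simp add: algebra_simps)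
    then have T: "T > 0" "geom_time \<rho> j + T = geom_time \<rho> (Suc j)" by (auto simp: T_def)
    let ?D = "\<lambda>k. cone_section a b (geom_time \<rho> j + k)"
    have e: "geom_time \<rho> (j + Suc d) - geom_time \<rho> j = T + (geom_time \<rho> (Suc j + d) - geom_time \<rho> (Suc j))"
      using geom_time_mono[OF \<rho>1, of "Suc j" "Suc j + d"] T by simp
    have DT: "?D (T - 1) = {a * real (geom_time \<rho> (Suc j))..b * real (geom_time \<rho> (Suc j))}"
      using T by (simp add: cone_section_def flip: T(2))
    have step: "stay \<mu> ?D T s \<le> ennreal ((\<rho> ^ j) powr (- (\<alpha> - 1) + \<delta>))"
    proof (rule j0[OF Suc.prems(1) T(1)])
      show "real T \<le> \<rho> * \<rho> ^ j" using sb(1)[of "Suc j"] by (simp add: T_def)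
      show "?D (T - 1) \<subseteq> {a * real (geom_time \<rho> (Suc j))..}" unfolding DT by auto
      have "a * real (geom_time \<rho> (Suc j)) \<ge> a * (\<rho> * \<rho> ^ j - 1)"
        using sb(2)[of "Suc j"] a by (intro mult_left_mono) auto
      moreover have "b * real (geom_time \<rho> j) \<le> b * \<rho> ^ j" using sb(1)[of j] a by (intro mult_left_mono) auto
      moreover have "a * (\<rho> * \<rho> ^ j - 1) - b * \<rho> ^ j = 2 * c * \<rho> ^ j - a"
        by (simp add: c_def algebra_simps)
      moreover have "a \<le> c * \<rho> ^ j" using j0' Suc.prems by auto
      ultimately show "c * \<rho> ^ j \<le> a * real (geom_time \<rho> (Suc j)) - s"
        using Suc.prems(2) by linarith
    qed
    have "stay \<mu> ?D (T + (geom_time \<rho> (Suc j + d) - geom_time \<rho> (Suc j))) s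
        \<le> ennreal (\<rho> powr (- \<gamma> * (\<Sum>l=Suc j..<Suc j + d. real l))) * stay \<mu> ?D T s"
    proof (rule stay_append_le)
      fix s' assume "s' \<in> ?D (T - 1)"
      then have "s' \<le> b * real (geom_time \<rho> (Suc j))" unfolding DT by simp
      from Suc.IH[OF _ this] Suc.prems(1)
      have "stay \<mu> (\<lambda>k. cone_section a b (geom_time \<rho> (Suc j) + k)) (geom_time \<rho> (Suc j + d) - geom_time \<rho> (Suc j)) s'
        \<le> ennreal (\<rho> powr (- \<gamma> * (\<Sum>l=Suc j..<Suc j + d. real l)))" by simp
      moreover have "(\<lambda>k. cone_section a b (geom_time \<rho> j + (T + k))) = (\<lambda>k. cone_section a b (geom_time \<rho> (Suc j) + k))"
        by (simp flip: T(2) add: add.assoc)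
      ultimately show "stay \<mu> (\<lambda>k. cone_section a b (geom_time \<rho> j + (T + k))) (geom_time \<rho> (Suc j + d) - geom_time \<rho> (Suc j)) s'
        \<le> ennreal (\<rho> powr (- \<gamma> * (\<Sum>l=Suc j..<Suc j + d. real l)))" by simp
    qed (use T in auto)
    also have "\<dots> \<le> ennreal (\<rho> powr (- \<gamma> * (\<Sum>l=Suc j..<Suc j + d. real l))) * ennreal ((\<rho> ^ j) powr (- (\<alpha> - 1) + \<delta>))"
      by (intro mult_left_mono step) auto
    also have "(\<rho> ^ j) powr (- (\<alpha> - 1) + \<delta>) = \<rho> powr (- \<gamma> * real j)"
    proof -
      have "- (\<alpha> - 1) + \<delta> = - \<gamma>" by (simp add: \<gamma>_def)
      moreover have "(\<rho> ^ j) powr (- \<gamma>) = \<rho> powr (- \<gamma> * real j)"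
        using \<rho>1 by (simp add: powr_powr mult.commute flip: powr_realpow)
      ultimately show ?thesis by (simp only:)
    qed
    also have "ennreal (\<rho> powr (- \<gamma> * (\<Sum>l=Suc j..<Suc j + d. real l))) * ennreal (\<rho> powr (- \<gamma> * real j))
       = ennreal (\<rho> powr (- \<gamma> * (\<Sum>l=j..<j + Suc d. real l)))"
    proof -
      define S where "S = (\<Sum>l=Suc j..<Suc j + d. real l)"
      have "(\<Sum>l=j..<j + Suc d. real l) = real j + S"
        unfolding S_def by (subst sum.atLeast_Suc_lessThan) auto
      moreover have "\<rho> powr (- \<gamma> * S) * \<rho> powr (- \<gamma> * real j) = \<rho> powr (- \<gamma> * (real j + S))"
        by (simp add: powr_add[symmetric] algebra_simps)
      ultimately show ?thesis
        unfolding S_def[symmetric] by (simp only: ennreal_mult[symmetric] powr_ge_zero)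
    qed
    finally show ?case unfolding e .
  qed
  have "stay \<mu> (cone_section a b) (geom_time \<rho> J) 0 \<le> ennreal (\<rho> powr (- \<gamma> * (\<Sum>l=j0..<J. real l)))" if "J \<ge> j0" for J
  proof -
    have "stay \<mu> (cone_section a b) (geom_time \<rho> j0 + (geom_time \<rho> (j0 + (J - j0)) - geom_time \<rho> j0)) 0
       \<le> ennreal (\<rho> powr (- \<gamma> * (\<Sum>l=j0..<j0 + (J - j0). real l))) * stay \<mu> (cone_section a b) (geom_time \<rho> j0) 0"
    proof (rule stay_append_le)
      fix s' assume "s' \<in> cone_section a b (geom_time \<rho> j0 - 1)"
      then have "s' \<le> b * real (geom_time \<rho> j0)" using sb(3)[of j0] by (simp add: cone_section_def)
      then show "stay \<mu> (\<lambda>k. cone_section a b (geom_time \<rho> j0 + k)) (geom_time \<rho> (j0 + (J - j0)) - geom_time \<rho> j0) s'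
         \<le> ennreal (\<rho> powr (- \<gamma> * (\<Sum>l=j0..<j0 + (J - j0). real l)))"
        by (rule main[OF order_refl])
    qed (use sb(3) in auto)
    also have "\<dots> \<le> ennreal (\<rho> powr (- \<gamma> * (\<Sum>l=j0..<j0 + (J - j0). real l))) * 1"
      by (intro mult_left_mono stay_le_1) auto
    finally show ?thesis using that geom_time_mono[OF \<rho>1 that] by simp
  qed
  then show ?thesis unfolding \<gamma>_def by blast
qed

text \<open>By continuity, \<open>\<rho>\<close> slightly above \<open>b / a\<close> and a small loss \<open>h\<close> in the exponent still beat the rate \<open>R\<close>;
the quadratic growth of the sum over the windows that end before \<open>n\<close> gives the square of \<open>ln n\<close>.\<close>
lemma stay_cone_le:
  assumes a: "0 < a" "a < b" and R: "R < (\<alpha> - 1) / (2 * (ln b - ln a))"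
  shows "eventually (\<lambda>n. stay \<mu> (cone_section a b) n 0 \<le> ennreal (exp (- R * (ln (real n))\<^sup>2))) sequentially"
proof -
  define d where "d = ln b - ln a"
  have d: "d > 0" using a by (simp add: d_def)
  have "((\<lambda>h. (\<alpha> - 1 - h) / (2 * (d + h))) \<longlongrightarrow> (\<alpha> - 1 - 0) / (2 * (d + 0))) (at_right 0)"
    using d by (intro tendsto_intros) auto
  then have "eventually (\<lambda>h. R < (\<alpha> - 1 - h) / (2 * (d + h))) (at_right 0)"
    by (rule order_tendstoD) (use R in \<open>simp add: d_def\<close>)
  moreover have "eventually (\<lambda>h::real. 0 < h \<and> h < min 1 (\<alpha> - 1)) (at_right 0)"
    using eventually_at_right[of 0 "1::real" "\<lambda>h. 0 < h \<and> h < min 1 (\<alpha> - 1)"] \<alpha>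
    by (auto intro!: exI[of _ "min 1 (\<alpha> - 1)"])
  ultimately have "eventually (\<lambda>h. R < (\<alpha> - 1 - h) / (2 * (d + h)) \<and> 0 < h \<and> h < min 1 (\<alpha> - 1)) (at_right 0)"
    by (rule eventually_conj)
  then obtain h where h: "R < (\<alpha> - 1 - h) / (2 * (d + h))" "0 < h" "h < 1" "h < \<alpha> - 1"
    using eventually_happens[of _ "at_right (0::real)"] by auto
  define r where "r = d + h"
  define \<rho> where "\<rho> = exp r"
  define \<gamma> where "\<gamma> = \<alpha> - 1 - h"
  have r: "r > 0" "\<rho> > 1" "\<gamma> > 0" using d h by (auto simp: r_def \<rho>_def \<gamma>_def)
  have "b / a = exp d" using a by (simp add: d_def exp_diff)
  then have "\<rho> > b / a" using h by (simp add: \<rho>_def r_def)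
  from stay_cone_geom_time_le[OF a this h(2,3)] obtain j0 where
    j0: "\<And>J. J \<ge> j0 \<Longrightarrow> stay \<mu> (cone_section a b) (geom_time \<rho> J) 0
           \<le> ennreal (\<rho> powr (- \<gamma> * (\<Sum>l=j0..<J. real l)))" by (auto simp: \<gamma>_def)
  define q where "q = real j0 * (real j0 - 1)"
  define f where "f L = \<gamma> * r * (((L / r - 1) * (L / r - 2) - q) / 2)" for L
  have "((\<lambda>L. f L / L\<^sup>2) \<longlongrightarrow> \<gamma> / (2 * r)) at_top"
    unfolding f_def using r by (real_asymp simp: field_simps)
  then have "eventually (\<lambda>L. R < f L / L\<^sup>2) at_top"
    by (rule order_tendstoD) (use h in \<open>simp add: \<gamma>_def r_def\<close>)
  moreover have "eventually (\<lambda>L. L > 0 \<and> L \<ge> r * (2 + real j0)) at_top"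
    by (intro eventually_conj eventually_gt_at_top eventually_ge_at_top)
  ultimately have "eventually (\<lambda>L. R * L\<^sup>2 \<le> f L \<and> L \<ge> r * (2 + real j0)) at_top"
    by eventually_elim (auto simp: field_simps)
  moreover have "filterlim (\<lambda>n. ln (real n)) at_top sequentially" by real_asymp
  ultimately have "eventually (\<lambda>n. R * (ln (real n))\<^sup>2 \<le> f (ln (real n)) \<and> ln (real n) \<ge> r * (2 + real j0)) sequentially"
    by (rule eventually_compose_filterlim)
  with eventually_gt_at_top[of 0] show ?thesis
  proof eventually_elim
    case (elim n)
    define x where "x = ln (real n) / r"
    define J where "J = nat \<lfloor>x\<rfloor>"
    have x: "x \<ge> 2 + real j0" using elim r by (simp add: x_def field_simps)
    then have J: "real J \<le> x" "x - 1 < real J" by (auto simp: J_def)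
    then have "J \<ge> j0" using x by linarith
    have "\<rho> ^ J = exp (real J * r)" by (simp add: \<rho>_def exp_of_nat_mult)
    also have "\<dots> \<le> exp (x * r)" using J r by simp
    also have "\<dots> = real n" using elim r by (simp add: x_def)
    finally have "geom_time \<rho> J \<le> n" using geom_time_bounds(1)[OF r(2), of J] by linarith
    then have "stay \<mu> (cone_section a b) n 0 \<le> stay \<mu> (cone_section a b) (geom_time \<rho> J) 0"
      by (intro stay_antimono) auto
    also have "\<dots> \<le> ennreal (\<rho> powr (- \<gamma> * (\<Sum>l=j0..<J. real l)))" by (rule j0) fact
    also have "\<dots> \<le> ennreal (exp (- R * (ln (real n))\<^sup>2))"
    proof (rule ennreal_leI)
      have "(x - 1) * (x - 2) \<le> real J * (real J - 1)"
        using x J by (intro mult_mono) auto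
      then have "((x - 1) * (x - 2) - q) / 2 \<le> (\<Sum>l=j0..<J. real l)"
        unfolding sum_real_atLeastLessThan[OF \<open>J \<ge> j0\<close>] q_def by (intro divide_right_mono) auto
      then have "f (ln (real n)) \<le> \<gamma> * r * (\<Sum>l=j0..<J. real l)"
        unfolding f_def x_def[symmetric] using r by (intro mult_left_mono) auto
      then have "R * (ln (real n))\<^sup>2 \<le> \<gamma> * r * (\<Sum>l=j0..<J. real l)" using elim by linarith
      then show "\<rho> powr (- \<gamma> * (\<Sum>l=j0..<J. real l)) \<le> exp (- R * (ln (real n))\<^sup>2)"
        by (simp add: \<rho>_def powr_def algebra_simps)
    qed
    finally show ?case .
  qed
qed

end

section \<open>Lower bound for the cone probability\<close>

context random_walk begin

text \<open>For lower bounds the first \<open>n\<close> steps are restricted to a specific scenario \<open>E\<close>.\<close>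
lemma stay_append_ge_subset:
  assumes D: "\<And>k. D k \<in> sets borel" and E: "\<And>k. E k \<in> sets borel" and n: "n > 0"
    and sub: "\<And>k. k < n \<Longrightarrow> E k \<subseteq> D k"
    and C: "\<And>s'. s' \<in> E (n - 1) \<Longrightarrow> C \<le> stay \<mu> (\<lambda>k. D (n + k)) m s'"
  shows "C * stay \<mu> E n s \<le> stay \<mu> D (n + m) s"
proof -
  let ?F = "\<lambda>k. if k < n then E k else D k"
  have "C * stay \<mu> E n s \<le> C * stay \<mu> ?F n s"
    by (intro mult_left_mono stay_mono) auto
  also have "\<dots> \<le> stay \<mu> ?F (n + m) s"
    by (rule stay_append_ge) (use assms in auto)
  also have "\<dots> \<le> stay \<mu> D (n + m) s"
    by (intro stay_mono) (use sub in auto)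
  finally show ?thesis .
qed

end

context heavy_tailed_walk begin

text \<open>If all steps lie within \<open>\<epsilon>\<close> of \<open>c\<close>, the walk stays within a narrow cone around the ray of slope \<open>c\<close>.\<close>
lemma stay_near_ray_ge:
  fixes c \<epsilon> :: real
  shows "emeasure \<mu> {c - \<epsilon><..<c + \<epsilon>} ^ n
    \<le> stay \<mu> (\<lambda>k. {s + (c - \<epsilon>) * real (Suc k)..s + (c + \<epsilon>) * real (Suc k)}) n s"
proof (induction n arbitrary: s)
  case (Suc n)
  let ?D = "\<lambda>s k. {s + (c - \<epsilon>) * real (Suc k)..s + (c + \<epsilon>) * real (Suc k)}"
  let ?B = "{c - \<epsilon><..<c + \<epsilon>}"
  have pw: "emeasure \<mu> ?B ^ n * indicator ?B x
     \<le> indicator (?D s 0) (s + x) * stay \<mu> (\<lambda>k. ?D s (Suc k)) n (s + x)" for x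
  proof (cases "x \<in> ?B")
    case True
    then have "s + x \<in> ?D s 0" by auto
    moreover have "stay \<mu> (?D (s + x)) n (s + x) \<le> stay \<mu> (\<lambda>k. ?D s (Suc k)) n (s + x)"
      using True by (intro stay_mono) (auto simp: algebra_simps)
    ultimately show ?thesis using Suc.IH[of "s + x"] True by simp
  qed simp
  have "emeasure \<mu> ?B ^ Suc n = (\<integral>\<^sup>+x. emeasure \<mu> ?B ^ n * indicator ?B x \<partial>\<mu>)"
    by (subst nn_integral_cmult_indicator) (auto simp: sets_eq mult.commute)
  also have "\<dots> \<le> stay \<mu> (?D s) (Suc n) s"
    unfolding stay.simps by (intro nn_integral_mono pw)
  finally show ?case .
qed simp

text \<open>There are of the order of \<open>z\<close> positions for the jump, each of probability \<open>z powr - \<alpha>\<close> up to lower order, and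
the rest of the path stays close to its start with probability at least one half.\<close>
lemma one_jump_probability:
  assumes \<eta>: "\<eta> > 0" "2 * \<eta> \<le> d" and C: "C > 0" and \<delta>: "\<delta> > 0"
  shows "eventually (\<lambda>z. \<forall>T. nat \<lfloor>\<eta> * z\<rfloor> \<le> T \<longrightarrow> real T \<le> C * z \<longrightarrow>
     ennreal (z powr (- (\<alpha> - 1) - \<delta>)) \<le>
       stay \<mu> (\<lambda>i. if i < nat \<lfloor>\<eta> * z\<rfloor> then {- (\<eta> * z)..(d + 2 * \<eta>) * z}
                   else {(d - \<eta>) * z..(d + 2 * \<eta>) * z}) T 0) at_top"
proof -
  obtain k where k: "k > 0" and ev1: "eventually (\<lambda>z. k * G z \<le> measure \<mu> {d * z<..(d + \<eta>) * z}) at_top"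
    using tail_diff_ge[of d "d + \<eta>"] \<eta> by auto
  have ev2: "eventually (\<lambda>z. z powr (- \<alpha> - \<delta> / 2) \<le> G z) at_top"
    by (rule tail_ge_powr) (use \<delta> in simp)
  have ev3: "eventually (\<lambda>z. \<forall>T::nat. real T \<le> C * z \<longrightarrow>
     ennreal (1/2) \<le> stay \<mu> (\<lambda>_. {- (\<eta> * z)..\<eta> * z}) T 0) at_top"
    by (rule stay_near_start) fact+
  have "filterlim (\<lambda>z::real. z powr (\<delta> / 2)) at_top at_top" using \<delta> by real_asymp
  then have ev4: "eventually (\<lambda>z::real. 4 / (\<eta> * k) \<le> z powr (\<delta> / 2)) at_top"
    by (simp add: filterlim_at_top)
  have ev5: "eventually (\<lambda>z. z \<ge> 2 / \<eta>) at_top" by (rule eventually_ge_at_top)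
  from ev1 ev2 ev3 ev4 ev5 show ?thesis
  proof eventually_elim
    case (elim z)
    have z: "z > 0" "\<eta> * z \<ge> 2" using elim(5) \<eta> by (auto simp: field_simps intro: less_le_trans[of 0 "2/\<eta>"])
    define w where "w = nat \<lfloor>\<eta> * z\<rfloor>"
    have w: "real w \<ge> \<eta> * z / 2" using z unfolding w_def by linarith
    show ?case unfolding w_def[symmetric]
    proof (intro allI impI)
      fix T assume T: "w \<le> T" "real T \<le> C * z"
      let ?B = "{d * z<..(d + \<eta>) * z}"
      have "k * z powr (- \<alpha> - \<delta> / 2) \<le> measure \<mu> ?B"
        using elim(1,2) k by (meson mult_left_mono less_imp_le order_trans)
      then have B: "ennreal (k * z powr (- \<alpha> - \<delta> / 2)) \<le> emeasure \<mu> ?B"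
        by (simp add: emeasure_eq_measure ennreal_leI)
      have e: "(d + \<eta>) * z + \<eta> * z = (d + 2 * \<eta>) * z" "d * z - \<eta> * z = (d - \<eta>) * z"
        by (auto simp: algebra_simps)
      have "z powr (- (\<alpha> - 1) - \<delta>) = z powr (- (\<alpha> - 1) - \<delta>) * 1" by simp
      also have "\<dots> \<le> z powr (- (\<alpha> - 1) - \<delta>) * (z powr (\<delta> / 2) * (\<eta> * k / 4))"
        using elim(4) \<eta> k by (intro mult_left_mono) (auto simp: field_simps)
      also have "\<dots> = (\<eta> * z / 2) * (k * z powr (- \<alpha> - \<delta> / 2)) * (1 / 2)"
      proof -
        have "z powr (- (\<alpha> - 1) - \<delta>) * z powr (\<delta> / 2) = z powr (1 + (- \<alpha> - \<delta> / 2))"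
          unfolding powr_add[symmetric] by (rule arg_cong[where f="\<lambda>t. z powr t"]) simp
        also have "\<dots> = z * z powr (- \<alpha> - \<delta> / 2)" using z by (subst powr_add) simp
        finally show ?thesis by simp
      qed
      finally have "ennreal (z powr (- (\<alpha> - 1) - \<delta>)) \<le> ennreal ((\<eta> * z / 2) * (k * z powr (- \<alpha> - \<delta> / 2)) * (1 / 2))"
        by (rule ennreal_leI)
      also have "\<dots> = ennreal (\<eta> * z / 2) * ennreal (k * z powr (- \<alpha> - \<delta> / 2)) * ennreal (1 / 2)"
        using z \<eta> k by (simp only: ennreal_mult[symmetric] mult_nonneg_nonneg less_imp_le powr_ge_zero divide_nonneg_nonneg zero_le_numeral)
      also have "\<dots> \<le> of_nat w * emeasure \<mu> ?B * stay \<mu> (\<lambda>_. {- (\<eta> * z)..\<eta> * z}) (T - 1) 0"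
      proof (intro mult_mono B)
        show "ennreal (\<eta> * z / 2) \<le> of_nat w"
          using w by (metis ennreal_leI ennreal_of_nat_eq_real_of_nat)
        show "ennreal (1 / 2) \<le> stay \<mu> (\<lambda>_. {- (\<eta> * z)..\<eta> * z}) (T - 1) 0"
          using elim(3) T by auto
      qed auto
      also have "\<dots> \<le> stay \<mu> (\<lambda>i. if i < w then {- (\<eta> * z)..(d + \<eta>) * z + \<eta> * z}
                   else {d * z - \<eta> * z..(d + \<eta>) * z + \<eta> * z}) T 0"
        by (rule stay_one_jump_ge) (use T \<eta> z in \<open>auto intro!: mult_right_mono simp flip: mult.assoc\<close>)
      finally show "ennreal (z powr (- (\<alpha> - 1) - \<delta>)) \<le> stay \<mu> (\<lambda>i. if i < w then {- (\<eta> * z)..(d + 2 * \<eta>) * z}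
                   else {(d - \<eta>) * z..(d + 2 * \<eta>) * z}) T 0"
        unfolding e .
    qed
  qed
qed

text \<open>The scenario: at time \<open>\<rho> ^ j\<close> the walk is near \<open>u \<rho> ^ j\<close>, with a slope \<open>u > a\<close>. It soon jumps up
by about \<open>d \<rho> ^ j\<close>, to a position near \<open>\<rho> u \<rho> ^ j\<close>, and waits there until time \<open>\<rho> ^ Suc j\<close>, when its slope has come
down to \<open>u\<close> again. The cone leaves room for this because \<open>a < u\<close> and \<open>\<rho> u < b\<close>. The scenario is started by steps close to a
support point \<open>c\<close> between \<open>u\<close> and \<open>b\<close>, followed by waiting until the slope has dropped from \<open>c\<close> to \<open>u\<close>.\<close>
lemma stay_cone_geom_time_ge:
  assumes a: "0 < a" "a < b" and \<rho>: "1 < \<rho>" "\<rho> < b / a" and \<delta>: "0 < \<delta>"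
    and pos: "measure \<mu> {a<..<b} > 0"
  shows "\<exists>j0. \<exists>C>0. \<forall>J\<ge>j0. ennreal (C * \<rho> powr (- (\<alpha> - 1 + \<delta>) * (\<Sum>l=j0..<J. real l)))
           \<le> stay \<mu> (cone_section a b) (geom_time \<rho> J) 0"
proof -
  obtain c where c: "a < c" "c < b" and supp: "\<And>\<epsilon>. \<epsilon> > 0 \<Longrightarrow> measure \<mu> {c - \<epsilon><..<c + \<epsilon>} > 0"
    using ex_support_point[OF pos] by auto
  have "a < b / \<rho>" using a \<rho> by (simp add: field_simps)
  with c obtain u where u: "a < u" "u < c" "u < b / \<rho>"
    using dense[of a "min c (b / \<rho>)"] by auto
  have u\<rho>: "\<rho> * u < b" "0 < u" "u < b * u / c" using u a \<rho> c by (auto simp: field_simps)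
  define d where "d = (\<rho> - 1) * u"
  have d: "d > 0" using \<rho> u\<rho> by (simp add: d_def)
  \<comment> \<open>The position at time \<open>\<rho> ^ j\<close> is known up to \<open>K \<eta> \<rho> ^ j\<close>. One window adds an error of at most \<open>2 \<eta> \<rho> ^ j\<close> while the admissible error grows by the factor \<open>\<rho>\<close>, so \<open>K + 2 \<le> \<rho> K\<close> reproduces the estimate; the summand 3 accommodates the error of the initial phase.\<close>
  define K where "K = 3 + 2 / (\<rho> - 1)"
  have K: "K \<ge> 3"
  proof -
    have "2 / (\<rho> - 1) > 0" using \<rho> by simp
    then show ?thesis unfolding K_def by linarith
  qed
  have K\<rho>: "\<rho> * K \<ge> K + 2"
  proof -
    have "\<rho> * K = K + (\<rho> - 1) * K" by (simp add: algebra_simps)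
    moreover have "(\<rho> - 1) * K = 3 * (\<rho> - 1) + 2" using \<rho> by (simp add: K_def field_simps)
    ultimately show ?thesis using \<rho> by simp
  qed
  \<comment> \<open>All constraints on the tolerance \<open>\<eta>\<close> are strict at \<open>\<eta> = 0\<close>. In this order: above the lower line until the jump, below the upper line, above the lower line until the end of the window, jumps larger than the fluctuations, jump phase shorter than the window, and the same for the initial phase.\<close>
  have "\<exists>\<eta>>0. a * (1 + \<eta>) \<le> u - K * \<eta> - \<eta> \<and> \<rho> * u + K * \<eta> + 2 * \<eta> \<le> b \<and> a * \<rho> \<le> \<rho> * u - K * \<eta> - \<eta>
      \<and> 2 * \<eta> \<le> d \<and> \<eta> < (\<rho> - 1) / 2 \<and> u + 2 * \<eta> \<le> b * u / c \<and> a \<le> u - 3 * \<eta>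
      \<and> \<eta> * c / u < c - a \<and> \<eta> * c / u < b - c"
  proof -
    have lin: "eventually (\<lambda>\<eta>::real. f \<eta> < g \<eta>) (at_right 0)"
      if "f 0 < g 0" "continuous_on UNIV f" "continuous_on UNIV g" for f g :: "real \<Rightarrow> real"
    proof -
      have "continuous_on UNIV (\<lambda>\<eta>. g \<eta> - f \<eta>)" using that by (intro continuous_intros)
      then have "((\<lambda>\<eta>. g \<eta> - f \<eta>) \<longlongrightarrow> g 0 - f 0) (at_right 0)"
        by (auto simp: continuous_on_def intro: tendsto_within_subset)
      then have "eventually (\<lambda>\<eta>. 0 < g \<eta> - f \<eta>) (at_right 0)"
        by (rule order_tendstoD) (use that in simp)
      then show ?thesis by simp
    qed
    have "eventually (\<lambda>\<eta>::real. \<eta> > 0) (at_right 0)" by (simp add: eventually_at_right_less)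
    moreover have "eventually (\<lambda>\<eta>. a * (1 + \<eta>) < u - K * \<eta> - \<eta>) (at_right 0)"
      by (rule lin) (use u in \<open>auto intro!: continuous_intros\<close>)
    moreover have "eventually (\<lambda>\<eta>. \<rho> * u + K * \<eta> + 2 * \<eta> < b) (at_right 0)"
      by (rule lin) (use u\<rho> in \<open>auto intro!: continuous_intros\<close>)
    moreover have "eventually (\<lambda>\<eta>. a * \<rho> < \<rho> * u - K * \<eta> - \<eta>) (at_right 0)"
      by (rule lin) (use u \<rho> in \<open>auto intro!: continuous_intros\<close>)
    moreover have "eventually (\<lambda>\<eta>. 2 * \<eta> < d) (at_right 0)"
      by (rule lin) (use d in \<open>auto intro!: continuous_intros\<close>)
    moreover have "eventually (\<lambda>\<eta>. \<eta> < (\<rho> - 1) / 2) (at_right 0)"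
      by (rule lin) (use \<rho> in \<open>auto intro!: continuous_intros\<close>)
    moreover have "eventually (\<lambda>\<eta>. u + 2 * \<eta> < b * u / c) (at_right 0)"
      by (rule lin) (use u\<rho> in \<open>auto intro!: continuous_intros\<close>)
    moreover have "eventually (\<lambda>\<eta>. a < u - 3 * \<eta>) (at_right 0)"
      by (rule lin) (use u in \<open>auto intro!: continuous_intros\<close>)
    moreover have "eventually (\<lambda>\<eta>. \<eta> * c / u < c - a) (at_right 0)"
      by (rule lin) (use c u\<rho> in \<open>auto intro!: continuous_intros\<close>)
    moreover have "eventually (\<lambda>\<eta>. \<eta> * c / u < b - c) (at_right 0)"
      by (rule lin) (use c u\<rho> in \<open>auto intro!: continuous_intros\<close>)
    ultimately have "eventually (\<lambda>\<eta>. \<eta> > 0 \<and> a * (1 + \<eta>) \<le> u - K * \<eta> - \<eta> \<and> \<rho> * u + K * \<eta> + 2 * \<eta> \<le> b \<and> a * \<rho> \<le> \<rho> * u - K * \<eta> - \<eta>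
      \<and> 2 * \<eta> \<le> d \<and> \<eta> < (\<rho> - 1) / 2 \<and> u + 2 * \<eta> \<le> b * u / c \<and> a \<le> u - 3 * \<eta>
      \<and> \<eta> * c / u < c - a \<and> \<eta> * c / u < b - c) (at_right 0)"
      by eventually_elim simp
    then show ?thesis using eventually_happens[of _ "at_right (0::real)"] by auto
  qed
  then obtain \<eta> where \<eta>: "\<eta> > 0" and
    \<eta>1: "a * (1 + \<eta>) \<le> u - K * \<eta> - \<eta>" and \<eta>2: "\<rho> * u + K * \<eta> + 2 * \<eta> \<le> b" and
    \<eta>3: "a * \<rho> \<le> \<rho> * u - K * \<eta> - \<eta>" and \<eta>4: "2 * \<eta> \<le> d" and \<eta>5: "\<eta> < (\<rho> - 1) / 2" and
    \<eta>6: "u + 2 * \<eta> \<le> b * u / c" and \<eta>7: "a \<le> u - 3 * \<eta>" and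
    \<eta>8: "\<eta> * c / u < c - a" "\<eta> * c / u < b - c" by blast
  define I where "I z = {(u - K * \<eta>) * z..(u + K * \<eta>) * z}" for z
  define \<gamma> where "\<gamma> = \<alpha> - 1 + \<delta>"
  note sb = geom_time_bounds[OF \<rho>(1)]
  have lim: "filterlim (\<lambda>j::nat. \<rho> ^ j) at_top sequentially" using \<rho> by real_asymp
  have evz: "eventually (\<lambda>z. z \<ge> 1 \<and> 2 < (\<rho> - 1) * z \<and> c \<le> \<eta> * z \<and> 1 < (1 - u / c) * z \<and> 1 \<le> u * z / c) at_top"
  proof -
    have "1 - u / c > 0" "u / c > 0" using u u\<rho> by auto
    then have "eventually (\<lambda>z::real. z \<ge> 1) at_top" "eventually (\<lambda>z. 2 < (\<rho> - 1) * z) at_top"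
      "eventually (\<lambda>z. c \<le> \<eta> * z) at_top" "eventually (\<lambda>z. 1 < (1 - u / c) * z) at_top"
      "eventually (\<lambda>z. 1 \<le> u / c * z) at_top"
      using \<rho> \<eta> by real_asymp+
    then show ?thesis by eventually_elim simp
  qed
  from eventually_compose_filterlim[OF eventually_conj[OF evz eventually_conj[OF
      one_jump_probability[OF \<eta> \<eta>4, of \<rho> \<delta>]  stay_near_start[OF \<eta>, of 1]]] lim] \<rho> \<delta>
  obtain j0 where
    big: "\<And>j. j \<ge> j0 \<Longrightarrow> \<rho> ^ j \<ge> 1 \<and> 2 < (\<rho> - 1) * \<rho> ^ j \<and> c \<le> \<eta> * \<rho> ^ j \<and> 1 < (1 - u / c) * \<rho> ^ j \<and> 1 \<le> u * \<rho> ^ j / c"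
    and jump: "\<And>j T. j \<ge> j0 \<Longrightarrow> nat \<lfloor>\<eta> * \<rho> ^ j\<rfloor> \<le> T \<Longrightarrow> real T \<le> \<rho> * \<rho> ^ j \<Longrightarrow>
      ennreal ((\<rho> ^ j) powr (- (\<alpha> - 1) - \<delta>)) \<le>
       stay \<mu> (\<lambda>i. if i < nat \<lfloor>\<eta> * \<rho> ^ j\<rfloor> then {- (\<eta> * \<rho> ^ j)..(d + 2 * \<eta>) * \<rho> ^ j}
                   else {(d - \<eta>) * \<rho> ^ j..(d + 2 * \<eta>) * \<rho> ^ j}) T 0"
    and near: "\<And>j T. j \<ge> j0 \<Longrightarrow> real T \<le> 1 * \<rho> ^ j \<Longrightarrow>
      ennreal (1/2) \<le> stay \<mu> (\<lambda>_. {- (\<eta> * \<rho> ^ j)..\<eta> * \<rho> ^ j}) T 0"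
    unfolding eventually_sequentially by fastforce
  have main: "ennreal (\<rho> powr (- \<gamma> * (\<Sum>l=j..<j + n. real l)))
      \<le> stay \<mu> (\<lambda>k. cone_section a b (geom_time \<rho> j + k)) (geom_time \<rho> (j + n) - geom_time \<rho> j) s"
    if "j \<ge> j0" "s \<in> I (\<rho> ^ j)" for j n s
    using that
  proof (induction n arbitrary: j s)
    case 0
    then show ?case using \<rho> by simp
  next
    case (Suc n)
    define z where "z = \<rho> ^ j"
    define T where "T = geom_time \<rho> (Suc j) - geom_time \<rho> j"
    define w where "w = nat \<lfloor>\<eta> * z\<rfloor>"
    note bigj = big[OF Suc.prems(1), folded z_def]
    have z: "z > 0" using bigj by simp
    have w: "real w \<le> \<eta> * z" unfolding w_def using z \<eta> by (intro of_nat_floor) simp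
    have m: "real (geom_time \<rho> j) \<le> z" "z < real (geom_time \<rho> j) + 1"
        "real (geom_time \<rho> (Suc j)) \<le> \<rho> * z" "\<rho> * z < real (geom_time \<rho> (Suc j)) + 1"
      using sb(1,2)[of j] sb(1,2)[of "Suc j"] by (auto simp: z_def)
    have wT': "real w < real (geom_time \<rho> (Suc j)) - real (geom_time \<rho> j)"
    proof -
      define q where "q = (\<rho> - 1) * z"
      have "\<eta> * z < q / 2" using mult_strict_right_mono[OF \<eta>5 z] by (simp add: q_def)
      moreover have "\<rho> * z - z = q" by (simp add: q_def algebra_simps)
      moreover have "2 < q" using bigj by (simp add: q_def)
      ultimately show ?thesis using w m by linarith
    qed
    then have wT: "w < T" and T: "T > 0" "geom_time \<rho> j + T = geom_time \<rho> (Suc j)"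
      by (auto simp: T_def)
    let ?D = "\<lambda>k. cone_section a b (geom_time \<rho> j + k)"
    \<comment> \<open>Before time \<open>w\<close> the jump may or may not have happened; from then on it has.\<close>
    define E where "E k = (if k < w then {s - \<eta> * z..s + (d + 2 * \<eta>) * z} else {s + (d - \<eta>) * z..s + (d + 2 * \<eta>) * z})" for k
    have e: "geom_time \<rho> (j + Suc n) - geom_time \<rho> j = T + (geom_time \<rho> (Suc j + n) - geom_time \<rho> (Suc j))"
      using geom_time_mono[OF \<rho>(1), of "Suc j" "Suc j + n"] T by simp
    have s: "(u - K * \<eta>) * z \<le> s" "s \<le> (u + K * \<eta>) * z" using Suc.prems(2) by (auto simp: I_def z_def)
    have up: "s + (d + 2 * \<eta>) * z \<le> (\<rho> * u + K * \<eta> + 2 * \<eta>) * z"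
      using s(2) by (simp add: d_def algebra_simps)
    have lo1: "(u - K * \<eta> - \<eta>) * z \<le> s - \<eta> * z"
      using s(1) by (simp add: algebra_simps)
    have lo2: "(\<rho> * u - K * \<eta> - \<eta>) * z \<le> s + (d - \<eta>) * z"
      using s(1) by (simp add: d_def algebra_simps)
    have sub: "E k \<subseteq> ?D k" if "k < T" for k
    proof -
      define t where "t = real (Suc (geom_time \<rho> j + k))"
      have t: "z \<le> t" using m by (simp add: t_def)
      have "s + (d + 2 * \<eta>) * z \<le> b * z" using up \<eta>2 z by (meson mult_right_mono less_imp_le order_trans)
      also have "\<dots> \<le> b * t" using t a by (intro mult_left_mono) auto
      finally have ub: "s + (d + 2 * \<eta>) * z \<le> b * t" .
      show ?thesis
      proof (cases "k < w")
        case True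
        then have "t \<le> (1 + \<eta>) * z" using w m by (simp add: t_def algebra_simps)
        then have "a * t \<le> a * ((1 + \<eta>) * z)" using a by (intro mult_left_mono) auto
        also have "\<dots> \<le> (u - K * \<eta> - \<eta>) * z" using \<eta>1 z by (simp flip: mult.assoc)
        finally have "a * t \<le> s - \<eta> * z" using lo1 by linarith
        then show ?thesis using ub True by (auto simp: E_def cone_section_def t_def simp del: of_nat_Suc of_nat_add)
      next
        case False
        have "Suc (geom_time \<rho> j + k) \<le> geom_time \<rho> (Suc j)" using that T by simp
        then have "t \<le> \<rho> * z" using m by (simp add: t_def)
        then have "a * t \<le> a * (\<rho> * z)" using a by (intro mult_left_mono) auto
        also have "\<dots> \<le> (\<rho> * u - K * \<eta> - \<eta>) * z" using \<eta>3 z by (simp flip: mult.assoc)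
        finally have "a * t \<le> s + (d - \<eta>) * z" using lo2 by linarith
        then show ?thesis using ub False by (auto simp: E_def cone_section_def t_def simp del: of_nat_Suc of_nat_add)
      qed
    qed
    have last: "E (T - 1) \<subseteq> I (\<rho> ^ Suc j)"
    proof -
      have *: "(K * \<eta> + 2 * \<eta>) * z \<le> \<rho> * (K * \<eta>) * z"
        using mult_right_mono[OF K\<rho>, of "\<eta> * z"] \<eta> z by (simp add: algebra_simps)
      have **: "(\<rho> * u + K * \<eta> + 2 * \<eta>) * z = \<rho> * u * z + (K * \<eta> + 2 * \<eta>) * z"
        "(u + K * \<eta>) * (\<rho> * z) = \<rho> * u * z + \<rho> * (K * \<eta>) * z"
        "(u - K * \<eta>) * (\<rho> * z) = \<rho> * u * z - \<rho> * (K * \<eta>) * z"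
        "(\<rho> * u - K * \<eta> - \<eta>) * z = \<rho> * u * z - (K * \<eta> + 2 * \<eta>) * z + \<eta> * z"
        by (simp_all add: algebra_simps)
      have pz: "0 < \<eta> * z" using \<eta> z by simp
      have "s + (d + 2 * \<eta>) * z \<le> (u + K * \<eta>) * (\<rho> * z)"
        using order_trans[OF up, of "(u + K * \<eta>) * (\<rho> * z)"] * unfolding **(1,2) by simp
      moreover have "(u - K * \<eta>) * (\<rho> * z) \<le> s + (d - \<eta>) * z"
        using order_trans[OF _ lo2, of "(u - K * \<eta>) * (\<rho> * z)"] * pz unfolding **(3,4) by simp
      moreover have "\<rho> ^ Suc j = \<rho> * z" by (simp add: z_def)
      ultimately show ?thesis using wT unfolding E_def I_def by auto
    qed
    have "ennreal (z powr (- (\<alpha> - 1) - \<delta>)) \<le>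
       stay \<mu> (\<lambda>i. if i < w then {- (\<eta> * z)..(d + 2 * \<eta>) * z} else {(d - \<eta>) * z..(d + 2 * \<eta>) * z}) T 0"
      unfolding z_def w_def
    proof (rule jump[OF Suc.prems(1)])
      show "real T \<le> \<rho> * \<rho> ^ j" using m(3) by (simp add: T_def z_def)
      show "nat \<lfloor>\<eta> * \<rho> ^ j\<rfloor> \<le> T" using wT by (simp add: w_def z_def)
    qed
    also have "\<dots> \<le> stay \<mu> E T (0 + s)"
      by (intro stay_translate_le) (auto simp: E_def split: if_splits)
    finally have step: "ennreal (\<rho> powr (- \<gamma> * real j)) \<le> stay \<mu> E T s"
    proof -
      assume *: "ennreal (z powr (- (\<alpha> - 1) - \<delta>)) \<le> stay \<mu> E T (0 + s)"
      have "- (\<alpha> - 1) - \<delta> = - \<gamma>" by (simp add: \<gamma>_def)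
      moreover have "z powr (- \<gamma>) = \<rho> powr (- \<gamma> * real j)"
        using \<rho> by (simp add: z_def powr_powr mult.commute flip: powr_realpow)
      ultimately show ?thesis using * by (simp only: add_0)
    qed
    have "ennreal (\<rho> powr (- \<gamma> * (\<Sum>l=j..<j + Suc n. real l)))
      = ennreal (\<rho> powr (- \<gamma> * (\<Sum>l=Suc j..<Suc j + n. real l))) * ennreal (\<rho> powr (- \<gamma> * real j))"
    proof -
      define S where "S = (\<Sum>l=Suc j..<Suc j + n. real l)"
      have "(\<Sum>l=j..<j + Suc n. real l) = real j + S"
        unfolding S_def by (subst sum.atLeast_Suc_lessThan) auto
      moreover have "\<rho> powr (- \<gamma> * S) * \<rho> powr (- \<gamma> * real j) = \<rho> powr (- \<gamma> * (real j + S))"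
        by (simp add: powr_add[symmetric] algebra_simps)
      ultimately show ?thesis
        unfolding S_def[symmetric] by (simp only: ennreal_mult[symmetric] powr_ge_zero)
    qed
    also have "\<dots> \<le> ennreal (\<rho> powr (- \<gamma> * (\<Sum>l=Suc j..<Suc j + n. real l))) * stay \<mu> E T s"
      by (intro mult_left_mono step) auto
    also have "\<dots> \<le> stay \<mu> ?D (T + (geom_time \<rho> (Suc j + n) - geom_time \<rho> (Suc j))) s"
    proof (rule stay_append_ge_subset)
      fix s' assume "s' \<in> E (T - 1)"
      then have "s' \<in> I (\<rho> ^ Suc j)" using last by blast
      from Suc.IH[OF _ this] Suc.prems(1)
      have "ennreal (\<rho> powr (- \<gamma> * (\<Sum>l=Suc j..<Suc j + n. real l))) \<le>
        stay \<mu> (\<lambda>k. cone_section a b (geom_time \<rho> (Suc j) + k)) (geom_time \<rho> (Suc j + n) - geom_time \<rho> (Suc j)) s'" by simp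
      moreover have "(\<lambda>k. cone_section a b (geom_time \<rho> j + (T + k))) = (\<lambda>k. cone_section a b (geom_time \<rho> (Suc j) + k))"
        by (simp flip: T(2) add: add.assoc)
      ultimately show "ennreal (\<rho> powr (- \<gamma> * (\<Sum>l=Suc j..<Suc j + n. real l))) \<le>
        stay \<mu> (\<lambda>k. cone_section a b (geom_time \<rho> j + (T + k))) (geom_time \<rho> (Suc j + n) - geom_time \<rho> (Suc j)) s'" by simp
    qed (use T sub in \<open>auto simp: E_def\<close>)
    finally show ?case unfolding e .
  qed
  define z where "z = \<rho> ^ j0"
  define m where "m = geom_time \<rho> j0"
  define \<epsilon> where "\<epsilon> = \<eta> * c / u"
  \<comment> \<open>A walk along the ray of slope \<open>c\<close> reaches the height \<open>u z\<close> at time \<open>u z / c\<close> and then waits until time \<open>z\<close>.\<close>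
  define n1 where "n1 = nat \<lfloor>u * z / c\<rfloor>"
  define p where "p = emeasure \<mu> {c - \<epsilon><..<c + \<epsilon>}"
  define T where "T = m - n1"
  note big0 = big[OF order_refl, folded z_def]
  have z: "z > 0" using big0 by simp
  have \<epsilon>: "\<epsilon> > 0" "a < c - \<epsilon>" "c + \<epsilon> < b" using \<eta> \<eta>8 c a u\<rho> by (auto simp: \<epsilon>_def)
  have uz: "0 \<le> u * z / c" using u\<rho> z c a by simp
  have n1: "real n1 \<le> u * z / c" "u * z / c < real n1 + 1" "n1 > 0"
  proof -
    show "real n1 \<le> u * z / c" unfolding n1_def using uz by (rule of_nat_floor)
    show "u * z / c < real n1 + 1" unfolding n1_def using uz by linarith
    have "1 \<le> u * z / c" using big0 by simp
    then show "n1 > 0" unfolding n1_def by simp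
  qed
  have m: "real m \<le> z" "z < real m + 1" using sb(1,2)[of j0] by (auto simp: m_def z_def)
  have "1 < z - u * z / c" using big0 by (simp add: algebra_simps)
  then have "real n1 < real m" using n1 m by linarith
  then have T: "T > 0" "n1 + T = m" by (auto simp: T_def)
  have cmp: "c * real n1 \<le> u * z" "u * z \<le> c * real n1 + c" "\<epsilon> * real n1 \<le> \<eta> * z"
  proof -
    have "c * real n1 \<le> c * (u * z / c)" using n1 c a by (intro mult_left_mono) auto
    then show "c * real n1 \<le> u * z" using c a by simp
    have "c * (u * z / c) \<le> c * (real n1 + 1)" using n1 c a by (intro mult_left_mono) auto
    then show "u * z \<le> c * real n1 + c" using c a by (simp add: distrib_left)
    have "\<epsilon> * real n1 \<le> \<epsilon> * (u * z / c)" using n1 \<epsilon> by (intro mult_left_mono) auto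
    also have "\<dots> = \<eta> * z" using c a u\<rho> by (simp add: \<epsilon>_def)
    finally show "\<epsilon> * real n1 \<le> \<eta> * z" .
  qed
  have start: "ennreal (enn2real (p ^ n1) / 2 * \<rho> powr (- \<gamma> * (\<Sum>l=j0..<J. real l)))
      \<le> stay \<mu> (cone_section a b) (geom_time \<rho> J) 0" if J: "J \<ge> j0" for J
  proof -
    define q where "q = \<rho> powr (- \<gamma> * (\<Sum>l=j0..<J. real l))"
    define n where "n = geom_time \<rho> J - m"
    have nJ: "m + n = geom_time \<rho> J" using geom_time_mono[OF \<rho>(1) J] by (simp add: n_def m_def)
    define E where "E k = {0 + (c - \<epsilon>) * real (Suc k)..0 + (c + \<epsilon>) * real (Suc k)}" for k
    have wait: "ennreal q * ennreal (1 / 2) \<le> stay \<mu> (\<lambda>k. cone_section a b (n1 + k)) (T + n) s" if s: "s \<in> E (n1 - 1)" for s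
    proof -
      have "s \<in> {(c - \<epsilon>) * real n1..(c + \<epsilon>) * real n1}" using s n1 by (simp add: E_def)
      then have s': "(u - 2 * \<eta>) * z \<le> s" "s \<le> (u + \<eta>) * z"
        using cmp big0 by (auto simp: algebra_simps)
      define F :: "nat \<Rightarrow> real set" where "F = (\<lambda>_. {s - \<eta> * z..s + \<eta> * z})"
      have "ennreal (1 / 2) \<le> stay \<mu> (\<lambda>_. {- (\<eta> * z)..\<eta> * z}) T 0"
        unfolding z_def by (rule near) (use m in \<open>auto simp: T_def z_def\<close>)
      also have "\<dots> \<le> stay \<mu> F T (0 + s)"
        by (intro stay_translate_le) (auto simp: F_def)
      finally have "ennreal q * ennreal (1 / 2) \<le> ennreal q * stay \<mu> F T s"
        by (intro mult_left_mono) auto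
      also have "\<dots> \<le> stay \<mu> (\<lambda>k. cone_section a b (n1 + k)) (T + n) s"
      proof (rule stay_append_ge_subset)
        fix k assume k: "k < T"
        define t where "t = real (Suc (n1 + k))"
        have "Suc (n1 + k) \<le> m" using k T by simp
        then have t: "t \<le> z" "u * z / c \<le> t" using m n1 by (auto simp: t_def)
        have "a * t \<le> a * z" using t a by (intro mult_left_mono) auto
        also have "\<dots> \<le> (u - 3 * \<eta>) * z" using \<eta>7 z by simp
        finally have lo: "a * t \<le> s - \<eta> * z" using s' by (simp add: algebra_simps)
        have "s + \<eta> * z \<le> (u + 2 * \<eta>) * z" using s' by (simp add: algebra_simps)
        also have "\<dots> \<le> b * u / c * z" using \<eta>6 z by (intro mult_right_mono) auto
        also have "\<dots> = b * (u * z / c)" by simp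
        also have "\<dots> \<le> b * t" using t a by (intro mult_left_mono) auto
        finally have "s + \<eta> * z \<le> b * t" .
        with lo show "F k \<subseteq> cone_section a b (n1 + k)"
          by (auto simp: F_def cone_section_def t_def simp del: of_nat_Suc of_nat_add)
      next
        fix s' assume "s' \<in> F (T - 1)"
        then have "s' \<in> {(u - 3 * \<eta>) * z..(u + 2 * \<eta>) * z}" using s' by (auto simp: F_def algebra_simps)
        moreover have "3 * \<eta> * z \<le> K * \<eta> * z" "2 * \<eta> * z \<le> K * \<eta> * z"
          using K \<eta> z by (auto intro!: mult_right_mono)
        ultimately have "s' \<in> I (\<rho> ^ j0)" by (auto simp: I_def z_def[symmetric] algebra_simps)
        from main[OF order_refl this, of "J - j0"] J
        have "ennreal q \<le> stay \<mu> (\<lambda>k. cone_section a b (m + k)) n s'" by (simp add: q_def n_def m_def)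
        moreover have "(\<lambda>k. cone_section a b (n1 + (T + k))) = (\<lambda>k. cone_section a b (m + k))"
          by (simp flip: T(2) add: add.assoc)
        ultimately show "ennreal q \<le> stay \<mu> (\<lambda>k. cone_section a b (n1 + (T + k))) n s'" by simp
      qed (use T in \<open>auto simp: F_def\<close>)
      finally show ?thesis .
    qed
    have "p ^ n1 \<le> stay \<mu> E n1 0" unfolding p_def E_def by (rule stay_near_ray_ge)
    then have "ennreal q * ennreal (1 / 2) * p ^ n1 \<le> ennreal q * ennreal (1 / 2) * stay \<mu> E n1 0"
      by (intro mult_left_mono) auto
    also have "\<dots> \<le> stay \<mu> (cone_section a b) (n1 + (T + n)) 0"
    proof (rule stay_append_ge_subset)
      fix k
      have "a * real (Suc k) \<le> (c - \<epsilon>) * real (Suc k)" "(c + \<epsilon>) * real (Suc k) \<le> b * real (Suc k)"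
        using \<epsilon> by (intro mult_right_mono; simp)+
      then show "E k \<subseteq> cone_section a b k" by (auto simp: E_def cone_section_def simp del: of_nat_Suc)
    qed (use n1 wait in \<open>auto simp: E_def\<close>)
    also have "n1 + (T + n) = geom_time \<rho> J" using nJ T by simp
    also have "ennreal q * ennreal (1 / 2) * p ^ n1 = ennreal (enn2real (p ^ n1) / 2 * q)"
    proof -
      have "p ^ n1 = ennreal (measure \<mu> {c - \<epsilon><..<c + \<epsilon>} ^ n1)"
        by (simp add: p_def emeasure_eq_measure ennreal_power)
      moreover define g where "g = measure \<mu> {c - \<epsilon><..<c + \<epsilon>} ^ n1"
      ultimately have "p ^ n1 = ennreal g" "g \<ge> 0" "q \<ge> 0" by (auto simp: q_def)
      moreover from this have "ennreal q * ennreal (1 / 2) * ennreal g = ennreal (q * (1 / 2) * g)"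
        by (simp only: ennreal_mult[symmetric] mult_nonneg_nonneg divide_nonneg_nonneg zero_le_one zero_le_numeral)
      ultimately show ?thesis by (simp add: mult_ac)
    qed
    finally show ?thesis by (simp add: q_def)
  qed
  have "enn2real (p ^ n1) / 2 > 0"
    using supp[OF \<epsilon>(1)] by (simp add: p_def emeasure_eq_measure ennreal_power)
  with start show ?thesis unfolding \<gamma>_def by blast
qed

text \<open>The windows up to the first one that ends after \<open>n\<close> are used, with \<open>\<rho>\<close> slightly below \<open>b / a\<close>.\<close>
lemma stay_cone_ge:
  assumes a: "0 < a" "a < b" and pos: "measure \<mu> {a<..<b} > 0"
    and R: "(\<alpha> - 1) / (2 * (ln b - ln a)) < R"
  shows "eventually (\<lambda>n. ennreal (exp (- R * (ln (real n))\<^sup>2)) \<le> stay \<mu> (cone_section a b) n 0) sequentially"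
proof -
  define d where "d = ln b - ln a"
  have d: "d > 0" using a by (simp add: d_def)
  have "((\<lambda>h. (\<alpha> - 1 + h) / (2 * (d - h))) \<longlongrightarrow> (\<alpha> - 1 + 0) / (2 * (d - 0))) (at_right 0)"
    using d by (intro tendsto_intros) auto
  then have "eventually (\<lambda>h. (\<alpha> - 1 + h) / (2 * (d - h)) < R) (at_right 0)"
    by (rule order_tendstoD) (use R in \<open>simp add: d_def\<close>)
  moreover have "eventually (\<lambda>h::real. 0 < h \<and> h < d) (at_right 0)"
    using eventually_at_right_real[OF d] by simp
  ultimately have "eventually (\<lambda>h. (\<alpha> - 1 + h) / (2 * (d - h)) < R \<and> 0 < h \<and> h < d) (at_right 0)"
    by (rule eventually_conj)
  then obtain h where h: "(\<alpha> - 1 + h) / (2 * (d - h)) < R" "0 < h" "h < d"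
    using eventually_happens[of _ "at_right (0::real)"] by auto
  define r where "r = d - h"
  define \<rho> where "\<rho> = exp r"
  define \<gamma> where "\<gamma> = \<alpha> - 1 + h"
  have r: "r > 0" "\<rho> > 1" "\<gamma> > 0" using d h \<alpha> by (auto simp: r_def \<rho>_def \<gamma>_def)
  have "b / a = exp d" using a by (simp add: d_def exp_diff)
  then have "\<rho> < b / a" using h by (simp add: \<rho>_def r_def)
  from stay_cone_geom_time_ge[OF a r(2) this h(2) pos] obtain j0 C where C: "C > 0" and
    j0: "\<And>J. J \<ge> j0 \<Longrightarrow> ennreal (C * \<rho> powr (- \<gamma> * (\<Sum>l=j0..<J. real l)))
           \<le> stay \<mu> (cone_section a b) (geom_time \<rho> J) 0" by (auto simp: \<gamma>_def)
  define f where "f L = \<gamma> * r * ((L / r + 1) * (L / r) / 2) - ln C" for L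
  have "((\<lambda>L. f L / L\<^sup>2) \<longlongrightarrow> \<gamma> / (2 * r)) at_top"
    unfolding f_def using r by (real_asymp simp: field_simps)
  then have "eventually (\<lambda>L. f L / L\<^sup>2 < R) at_top"
    by (rule order_tendstoD) (use h in \<open>simp add: \<gamma>_def r_def\<close>)
  moreover have "eventually (\<lambda>L. L > 0 \<and> L \<ge> r * real j0) at_top"
    by (intro eventually_conj eventually_gt_at_top eventually_ge_at_top)
  ultimately have "eventually (\<lambda>L. f L \<le> R * L\<^sup>2 \<and> L \<ge> r * real j0 \<and> L > 0) at_top"
    by eventually_elim (auto simp: field_simps)
  moreover have "filterlim (\<lambda>n. ln (real n)) at_top sequentially" by real_asymp
  ultimately have "eventually (\<lambda>n. f (ln (real n)) \<le> R * (ln (real n))\<^sup>2 \<and> ln (real n) \<ge> r * real j0 \<and> ln (real n) > 0) sequentially"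
    by (rule eventually_compose_filterlim)
  with eventually_gt_at_top[of 0] show ?thesis
  proof eventually_elim
    case (elim n)
    define x where "x = ln (real n) / r"
    define J where "J = Suc (nat \<lfloor>x\<rfloor>)"
    have x: "x \<ge> real j0" "x > 0" using elim r by (auto simp: x_def field_simps)
    then have "real (nat \<lfloor>x\<rfloor>) = of_int \<lfloor>x\<rfloor>" by simp
    then have J: "real J \<le> x + 1" "x < real J" unfolding J_def by linarith+
    then have "J \<ge> j0" using x by linarith
    have "real n = exp (x * r)" using elim r by (simp add: x_def)
    also have "\<dots> \<le> exp (real J * r)" using J r by simp
    also have "\<dots> = \<rho> ^ J" by (simp add: \<rho>_def exp_of_nat_mult)
    finally have "n \<le> geom_time \<rho> J" unfolding geom_time_def by (simp add: le_nat_floor)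
    have "ennreal (exp (- R * (ln (real n))\<^sup>2)) \<le> ennreal (C * \<rho> powr (- \<gamma> * (\<Sum>l=j0..<J. real l)))"
    proof (rule ennreal_leI)
      have "0 \<le> real j0 * (real j0 - 1)" by (cases j0) auto
      moreover have "real J * (real J - 1) \<le> (x + 1) * x"
        using x J by (intro mult_mono) (auto simp: J_def)
      ultimately have "(\<Sum>l=j0..<J. real l) \<le> (x + 1) * x / 2"
        unfolding sum_real_atLeastLessThan[OF \<open>J \<ge> j0\<close>] by (intro divide_right_mono) auto
      then have "\<gamma> * r * (\<Sum>l=j0..<J. real l) - ln C \<le> f (ln (real n))"
        unfolding f_def x_def[symmetric] using r by (intro diff_right_mono mult_left_mono) auto
      then have "- R * (ln (real n))\<^sup>2 \<le> ln C + - (\<gamma> * r * (\<Sum>l=j0..<J. real l))" using elim by linarith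
      then have "exp (- R * (ln (real n))\<^sup>2) \<le> exp (ln C + - (\<gamma> * r * (\<Sum>l=j0..<J. real l)))" by simp
      also have "\<dots> = C * \<rho> powr (- \<gamma> * (\<Sum>l=j0..<J. real l))"
        using C by (simp only: exp_add) (simp add: \<rho>_def powr_def algebra_simps)
      finally show "exp (- R * (ln (real n))\<^sup>2) \<le> C * \<rho> powr (- \<gamma> * (\<Sum>l=j0..<J. real l))" .
    qed
    also have "\<dots> \<le> stay \<mu> (cone_section a b) (geom_time \<rho> J) 0" by (rule j0) fact
    also have "\<dots> \<le> stay \<mu> (cone_section a b) n 0"
      using \<open>n \<le> geom_time \<rho> J\<close> by (intro stay_antimono) auto
    finally show ?case .
  qed
qed

end

section \<open>The limit in one dimension and the product formula\<close>

context heavy_tailed_walk begin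

lemma tendsto_ln_stay_cone:
  assumes a: "0 < a" "a < b" and pos: "measure \<mu> {a<..<b} > 0"
  defines "p \<equiv> \<lambda>n. enn2real (stay \<mu> (cone_section a b) n 0)"
  shows "(\<lambda>n. ln (p n) / (ln (real n))\<^sup>2) \<longlonglongrightarrow> - ((\<alpha> - 1) / (2 * (ln b - ln a)))"
    and "eventually (\<lambda>n. p n > 0) sequentially"
proof -
  let ?R = "(\<alpha> - 1) / (2 * (ln b - ln a))"
  have p: "stay \<mu> (cone_section a b) n 0 = ennreal (p n)" for n
    using stay_le_1[of "cone_section a b" n 0] unfolding p_def
    by (intro ennreal_enn2real[symmetric]) (auto simp: less_top[symmetric] top_unique)
  have p0: "p n \<ge> 0" for n by (simp add: p_def)
  have lower: "eventually (\<lambda>n. exp (- R * (ln (real n))\<^sup>2) \<le> p n) sequentially" if "?R < R" for R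
    using stay_cone_ge[OF a pos that] by (simp add: p p0)
  have upper: "eventually (\<lambda>n. p n \<le> exp (- R * (ln (real n))\<^sup>2)) sequentially" if "R < ?R" for R
    using stay_cone_le[OF a that] by (simp add: p)
  show pos: "eventually (\<lambda>n. p n > 0) sequentially"
    using lower[of "?R + 1"] by (auto elim!: eventually_mono intro: less_le_trans[OF exp_gt_zero])
  have L: "eventually (\<lambda>n. (ln (real n))\<^sup>2 > 0) sequentially"
    using eventually_gt_at_top[of 1] by eventually_elim simp
  show "(\<lambda>n. ln (p n) / (ln (real n))\<^sup>2) \<longlonglongrightarrow> - ?R"
  proof (rule order_tendstoI)
    fix y assume "y < - ?R"
    then obtain R where R: "?R < R" "R < - y" using dense[of ?R "- y"] by auto
    show "eventually (\<lambda>n. y < ln (p n) / (ln (real n))\<^sup>2) sequentially"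
      using lower[OF R(1)] L
    proof eventually_elim
      case (elim n)
      then have "- R * (ln (real n))\<^sup>2 \<le> ln (p n)"
        by (metis exp_gt_zero ln_exp ln_le_cancel_iff less_le_trans)
      then have "- R \<le> ln (p n) / (ln (real n))\<^sup>2" using elim by (simp add: pos_le_divide_eq)
      then show ?case using R by linarith
    qed
  next
    fix y assume "- ?R < y"
    then obtain R where R: "- y < R" "R < ?R" using dense[of "- y" ?R] by auto
    show "eventually (\<lambda>n. ln (p n) / (ln (real n))\<^sup>2 < y) sequentially"
      using upper[OF R(2)] L pos
    proof eventually_elim
      case (elim n)
      then have "ln (p n) \<le> - R * (ln (real n))\<^sup>2"
        by (metis exp_gt_zero ln_exp ln_le_cancel_iff)
      then have "ln (p n) / (ln (real n))\<^sup>2 \<le> - R" using elim by (simp add: pos_divide_le_eq)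
      then show ?case using R by linarith
    qed
  qed
qed

end

lemma mem_cone_section_iff:
  "(1 / real (Suc k)) * s \<in> {a..b} \<longleftrightarrow> s \<in> cone_section a b k"
  by (auto simp: cone_section_def field_simps)

theorem corollary2p4:
  fixes M :: "'a measure" and X :: "'a \<Rightarrow> real ^ 'd"
    and N :: "'b measure" and Y :: "nat \<Rightarrow> 'b \<Rightarrow> real ^ 'd"
    and \<alpha> :: "'d \<Rightarrow> real" and L :: "'d \<Rightarrow> real \<Rightarrow> real"
    and a b :: "real ^ 'd"
  assumes "prob_space M"
    and "X \<in> borel_measurable M"
    and "prob_space.indep_vars M (\<lambda>_. borel) (\<lambda>i \<omega>. X \<omega> $ i) UNIV"
    and "\<And>i. \<alpha> i > 1"
    and "\<And>i. slowly_varying (L i)"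
    and "\<And>i. has_bochner_integral M (\<lambda>\<omega>. X \<omega> $ i) 0"
    and "\<And>i x. x > 0 \<Longrightarrow> measure M {\<omega> \<in> space M. X \<omega> $ i > x} = x powr (- \<alpha> i) * L i x"
    and "\<And>i. Limsup at_top (\<lambda>x::real. ereal (measure M {\<omega> \<in> space M. X \<omega> $ i < - x} /
                                         measure M {\<omega> \<in> space M. X \<omega> $ i > x})) \<in> {0..<\<infinity>}"
    and "\<And>i. 0 < a $ i" and "\<And>i. a $ i < b $ i"
    and "\<And>i. measure M {\<omega> \<in> space M. X \<omega> $ i \<in> {a $ i<..<b $ i}} > 0"
    and "prob_space N"
    and "iid_copies N Y M X"
  shows "(\<lambda>n::nat. 1 / (ln (real n))\<^sup>2 *
            ln (measure N {\<omega> \<in> space N. \<forall>k\<in>{1..n}.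
                  (1 / real k) *\<^sub>R (\<Sum>j<k. Y j \<omega>) \<in> {y. \<forall>i. y $ i \<in> {a $ i..b $ i}}}))
         \<longlonglongrightarrow> - (1 / 2) * (\<Sum>i\<in>UNIV. (\<alpha> i - 1) / (ln (b $ i) - ln (a $ i)))"
proof -
  interpret M: prob_space M by fact
  interpret N: prob_space N by fact
  note X = assms(2) and ind = assms(3)
  have Xi [measurable]: "(\<lambda>\<omega>. X \<omega> $ i) \<in> borel_measurable M" for i
    using ind by (auto simp: M.indep_vars_def)
  define \<nu> where "\<nu> i = distr M borel (\<lambda>\<omega>. X \<omega> $ i)" for i
  have \<nu>: "measure (\<nu> i) A = measure M {\<omega> \<in> space M. X \<omega> $ i \<in> A}" if "A \<in> sets borel" for i A
    unfolding \<nu>_def by (subst measure_distr) (use that in \<open>auto intro!: arg_cong[where f="measure M"]\<close>)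
  have tail: "measure (\<nu> i) {x<..} = x powr (- \<alpha> i) * L i x" if "x > 0" for i x
    using assms(7)[OF that, of i] by (subst \<nu>) auto
  have L: "L i x > 0" if "x > 0" for i x
    using assms(5)[of i] that by (simp add: slowly_varying_def)
  have walk: "heavy_tailed_walk (\<nu> i) (\<alpha> i)" for i
  proof -
    interpret prob_space "\<nu> i" unfolding \<nu>_def by (rule M.prob_space_distr) measurable
    have int: "integrable M (\<lambda>\<omega>. X \<omega> $ i)" "(\<integral>\<omega>. X \<omega> $ i \<partial>M) = 0"
      using assms(6)[of i] by (auto simp: has_bochner_integral_iff)
    show ?thesis
    proof unfold_locales
      show "sets (\<nu> i) = sets borel" by (simp add: \<nu>_def)
      show "integrable (\<nu> i) (\<lambda>x. x)" using int by (simp add: \<nu>_def integrable_distr_eq)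
      show "(\<integral>x. x \<partial>\<nu> i) = 0" using int by (simp add: \<nu>_def integral_distr)
      show "\<alpha> i > 1" by fact
      show "0 < measure (\<nu> i) {x<..}" if "x > 0" for x
        using that L[OF that] by (simp add: tail)
      show "((\<lambda>x. measure (\<nu> i) {t * x<..} / measure (\<nu> i) {x<..}) \<longlongrightarrow> t powr - \<alpha> i) at_top" if t: "t > 0" for t
      proof -
        have "((\<lambda>x. t powr - \<alpha> i * (L i (t * x) / L i x)) \<longlongrightarrow> t powr - \<alpha> i * 1) at_top"
          using assms(5)[of i] t by (intro tendsto_intros) (auto simp: slowly_varying_def)
        moreover have "eventually (\<lambda>x. t powr - \<alpha> i * (L i (t * x) / L i x) = measure (\<nu> i) {t * x<..} / measure (\<nu> i) {x<..}) at_top"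
          using eventually_gt_at_top[of 0]
        proof eventually_elim
          case (elim x)
          then show ?case using t by (simp add: tail powr_mult)
        qed
        ultimately show ?thesis by (simp add: Lim_transform_eventually)
      qed
    qed
  qed
  define D where "D i = cone_section (a $ i) (b $ i)" for i
  define p where "p i n = enn2real (stay (\<nu> i) (D i) n 0)" for i n
  have event: "{\<omega> \<in> space N. \<forall>k\<in>{1..n}. (1 / real k) *\<^sub>R (\<Sum>j<k. Y j \<omega>) \<in> {y. \<forall>i. y $ i \<in> {a $ i..b $ i}}}
      = {\<omega> \<in> space N. \<forall>k<n. (\<Sum>j\<le>k. Y j \<omega>) \<in> {y. \<forall>i. y $ i \<in> D i k}}" for n
  proof -
    have "(1 / real (Suc k)) *\<^sub>R y \<in> {y. \<forall>i. y $ i \<in> {a $ i..b $ i}} \<longleftrightarrow> y \<in> {y. \<forall>i. y $ i \<in> D i k}" for k and y :: "real ^ 'd"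
      unfolding mem_Collect_eq D_def vector_scaleR_component real_scaleR_def mem_cone_section_iff ..
    moreover have "(\<forall>k\<in>{1..n}. Q k) \<longleftrightarrow> (\<forall>k<n. Q (Suc k))" for Q
      by (metis One_nat_def Suc_le_eq Suc_le_mono atLeastAtMost_iff le0 not0_implies_Suc not_less_eq_eq)
    ultimately show ?thesis by (simp only: lessThan_Suc_atMost)
  qed
  have box: "{y :: real ^ 'd. \<forall>i. y $ i \<in> D i k} \<in> sets borel" for k
  proof -
    have "{y :: real ^ 'd. \<forall>i. y $ i \<in> D i k} = cbox (\<chi> i. a $ i * real (Suc k)) (\<chi> i. b $ i * real (Suc k))"
      by (auto simp: D_def cone_section_def mem_box_cart)
    then show ?thesis by simp
  qed
  have meas: "measure N {\<omega> \<in> space N. \<forall>k\<in>{1..n}. (1 / real k) *\<^sub>R (\<Sum>j<k. Y j \<omega>) \<in> {y. \<forall>i. y $ i \<in> {a $ i..b $ i}}}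
      = (\<Prod>i\<in>UNIV. p i n)" for n
  proof -
    have "emeasure N {\<omega> \<in> space N. \<forall>k<n. (\<Sum>j\<le>k. Y j \<omega>) \<in> {y. \<forall>i. y $ i \<in> D i k}}
      = stay (distr M borel X) (\<lambda>k. {y. \<forall>i. y $ i \<in> D i k}) n 0"
      by (rule N.emeasure_iid_walk_eq_stay) (use assms(13) box in \<open>auto simp: iid_copies_def\<close>)
    also have "\<dots> = (\<Prod>i\<in>UNIV. stay (\<nu> i) (D i) n 0)"
      unfolding \<nu>_def by (subst M.stay_eq_prod_components[OF X ind]) (auto simp: D_def)
    also have "\<dots> = (\<Prod>i\<in>UNIV. ennreal (p i n))"
    proof (intro prod.cong refl)
      fix i
      interpret heavy_tailed_walk "\<nu> i" "\<alpha> i" by (rule walk)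
      show "stay (\<nu> i) (D i) n 0 = ennreal (p i n)"
        using stay_le_1[of "D i" n 0] unfolding p_def
        by (intro ennreal_enn2real[symmetric]) (auto simp: less_top[symmetric] top_unique)
    qed
    also have "\<dots> = ennreal (\<Prod>i\<in>UNIV. p i n)"
      by (rule prod_ennreal) (simp add: p_def)
    finally show ?thesis
      unfolding event by (simp add: measure_def p_def prod_nonneg)
  qed
  have lim: "(\<lambda>n. ln (p i n) / (ln (real n))\<^sup>2) \<longlonglongrightarrow> - ((\<alpha> i - 1) / (2 * (ln (b $ i) - ln (a $ i))))"
    and pos: "eventually (\<lambda>n. p i n > 0) sequentially" for i
  proof -
    interpret heavy_tailed_walk "\<nu> i" "\<alpha> i" by (rule walk)
    have "measure (\<nu> i) {a $ i<..<b $ i} > 0" using assms(11)[of i] by (subst \<nu>) auto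
    from tendsto_ln_stay_cone[OF assms(9,10) this]
    show "(\<lambda>n. ln (p i n) / (ln (real n))\<^sup>2) \<longlonglongrightarrow> - ((\<alpha> i - 1) / (2 * (ln (b $ i) - ln (a $ i))))"
      "eventually (\<lambda>n. p i n > 0) sequentially" by (simp_all only: p_def D_def)
  qed
  have "(\<lambda>n. \<Sum>i\<in>UNIV. ln (p i n) / (ln (real n))\<^sup>2) \<longlonglongrightarrow> (\<Sum>i\<in>UNIV. - ((\<alpha> i - 1) / (2 * (ln (b $ i) - ln (a $ i)))))"
    by (intro tendsto_sum lim)
  moreover have "eventually (\<lambda>n. (\<Sum>i\<in>UNIV. ln (p i n) / (ln (real n))\<^sup>2) = 1 / (ln (real n))\<^sup>2 * ln (\<Prod>i\<in>UNIV. p i n)) sequentially"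
  proof -
    have "eventually (\<lambda>n. \<forall>i. p i n > 0) sequentially"
      using pos by (simp add: eventually_all_finite)
    then show ?thesis
    proof eventually_elim
      case (elim n)
      have "p i n \<noteq> 0" for i using elim by (simp add: less_imp_neq[symmetric])
      then have "ln (\<Prod>i\<in>UNIV. p i n) = (\<Sum>i\<in>UNIV. ln (p i n))" by (intro ln_prod) auto
      then show ?case by (simp add: sum_divide_distrib)
    qed
  qed
  ultimately have "(\<lambda>n. 1 / (ln (real n))\<^sup>2 * ln (\<Prod>i\<in>UNIV. p i n)) \<longlonglongrightarrow> (\<Sum>i\<in>UNIV. - ((\<alpha> i - 1) / (2 * (ln (b $ i) - ln (a $ i)))))"
    by (rule Lim_transform_eventually)
  moreover have "(\<Sum>i\<in>UNIV. - ((\<alpha> i - 1) / (2 * (ln (b $ i) - ln (a $ i))))) = - (1 / 2) * (\<Sum>i\<in>UNIV. (\<alpha> i - 1) / (ln (b $ i) - ln (a $ i)))"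
    unfolding sum_distrib_left by (intro sum.cong) auto
  ultimately show ?thesis unfolding meas by (simp only:)
qed

end
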